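(* Let $\mathcal{K}\subsetneqq\mathbb{R}^m$ be a regular cone, let $f\in\mathcal{B}_\theta(\mathcal{K})$ for some $\theta\ge1$, let $\mathsf{A}:\mathbb{R}^n\to\mathbb{R}^m$ be a linear operator, and let $h:\mathbb{R}^n\to\mathbb{R}\cup\{+\infty\}$ be proper, closed and convex, with $\mathcal{X}:=\operatorname{dom}h$ nonempty, convex and compact, and $\mathsf{A}(\mathcal{X})\cap\operatorname{dom}f\neq\emptyset$. Let $F(x):=f(\mathsf{A}x)+h(x)$, $F^*:=\min_{x\in\mathbb{R}^n}F(x)$, and $R_h:=\max_{x,y\in\mathcal{X}}|h(x)-h(y)|$. Suppose that the generalized Frank-Wolfe method with adaptive step-size (Algorithm 1, described in the context) is initiated at $x^0\in\bar{\mathcal{X}}:=\mathcal{X}\cap\mathsf{A}^{-1}(\operatorname{dom}f)$. Let $G_k$ be the Frank-Wolfe gap computed at iteration $k$, let $\delta_k:=F(x^k)-F^*$ be the optimality gap at iteration $k$ (so $\delta_0$ is the initial optimality gap), and let $\varepsilon>0$. 1. At iteration $k$ of Algorithm 1 the following hold: (a) If $G_k>\theta+R_h$, then the optimality gap decreases at least linearly at the iteration: $$\delta_{k+1}\le\left(1-\frac{1}{5.3(\delta_0+\theta+R_h)}\right)\delta_k .$$ (b) If $G_k\le\theta+R_h$, then the inverse optimality gap increases by at least a constant at the iteration: $$\frac{1}{\delta_{k+1}}\ge\frac{1}{\delta_k}+\frac{1}{12(\theta+R_h)^2}.$$ (c) The number of iterations $K_{\mathrm{Lin}}$ where $G_k>\theta+R_h$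 occurs is bounded from above as follows: $$K_{\mathrm{Lin}}\le\left\lceil 5.3(\delta_0+\theta+R_h)\ln(10.6\,\delta_0)\right\rceil .$$ 2. Let $K_\varepsilon$ denote the number of iterations required by Algorithm 1 to obtain $\delta_k\le\varepsilon$. Then $$K_\varepsilon\le\left\lceil 5.3(\delta_0+\theta+R_h)\ln(10.6\,\delta_0)\right\rceil+\left\lceil 12(\theta+R_h)^2\max\left\{\frac1\varepsilon-\frac1{\delta_0},0\right\}\right\rceil .$$ 3. Let $\mathrm{FWGAP}_\varepsilon$ denote the number of iterations required by Algorithm 1 to obtain $G_k\le\varepsilon$. Then $$\mathrm{FWGAP}_\varepsilon\le\left\lceil 5.3(\delta_0+\theta+R_h)\ln(10.6\,\delta_0)\right\rceil+\left\lceil\frac{24(\theta+R_h)^2}{\varepsilon}\right\rceil .$$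
   Context: A cone $\mathcal{K}\subsetneqq\mathbb{R}^m$ is regular if it is closed, convex, pointed (contains no line) and has nonempty interior. For $\theta\ge1$, $f\in\mathcal{B}_\theta(\mathcal{K})$ means that $f:\mathbb{R}^m\to\mathbb{R}\cup\{+\infty\}$ is a $\theta$-logarithmically-homogeneous (non-degenerate) self-concordant barrier on $\mathcal{K}$: $f$ is convex with $\operatorname{dom}f=\operatorname{int}\mathcal{K}$, is three-times differentiable and strictly convex on $\operatorname{int}\mathcal{K}$, and, with $H(u)$ the Hessian of $f$ at $u$, satisfies: (P1) $|D^3f(u)[w,w,w]|\le2\langle H(u)w,w\rangle^{3/2}$ for all $u\in\operatorname{int}\mathcal{K}$, $w\in\mathbb{R}^m$; (P2) $f(u_k)\to\infty$ for any $\{u_k\}_{k\ge1}\subseteq\operatorname{int}\mathcal{K}$ with $u_k\to u\in\operatorname{bd}\mathcal{K}$; (P3) $f(tu)=f(u)-\theta\ln t$ for all $u\in\operatorname{int}\mathcal{K}$, $t>0$. Local norm: $\|w\|_u:=\sqrt{\langle w,H(u)w\rangle}$ for $u\in\operatorname{int}\mathcal{K}$, $w\in\mathbb{R}^m$. The minimum $F^*$ is attained. Algorithm 1. Input: $x^0\in\bar{\mathcal{X}}$. At iteration $k=0,1,\ldots$: 1. Compute $\nabla f(\mathsf{A}x^k)$ and $v^k\in\arg\min_{x\in\mathbb{R}^n}\langle\nabla f(\mathsf{A}x^k),\mathsf{A}x\rangle+h(x)$. 2. Compute $G_k:=\langle\nabla f(\mathsf{A}x^k),\mathsf{A}(x^k-v^k)\rangle+h(x^k)-h(v^k)$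 and $D_k:=\|\mathsf{A}(v^k-x^k)\|_{\mathsf{A}x^k}$, and the step-size $\alpha_k:=\min\left\{\frac{G_k}{D_k(G_k+D_k)},1\right\}$. 3. Update $x^{k+1}:=x^k+\alpha_k(v^k-x^k)$. All iterates lie in $\bar{\mathcal{X}}$.
   Formalization: It is additionally assumed that A(X) is contained in K (1(a) fails without it) and that h has bounded variation on X, so R_h (a supremum) is finite; the term ⌈5.3(δ_0+θ+R_h)ln(10.6δ_0)⌉ is replaced by its positive part, as it can be negative when δ_0<1/10.6. *)

theory Defs
  imports "HOL-Analysis.Analysis"
begin

section \<open>Extended-real-valued convex functions\<close>

definition edom :: "('a \<Rightarrow> ereal) \<Rightarrow> 'a set" where
  "edom h = {x. h x < \<infinity>}"

definition ext_epigraph :: "('a \<Rightarrow> ereal) \<Rightarrow> ('a \<times> real) set" where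
  "ext_epigraph h = {(x, r). h x \<le> ereal r}"

definition proper_fun :: "('a \<Rightarrow> ereal) \<Rightarrow> bool" where
  "proper_fun h \<longleftrightarrow> (\<forall>x. h x \<noteq> -\<infinity>) \<and> edom h \<noteq> {}"

definition closed_fun :: "('a::topological_space \<Rightarrow> ereal) \<Rightarrow> bool" where
  "closed_fun h \<longleftrightarrow> closed (ext_epigraph h)"

definition convex_fun :: "('a::real_vector \<Rightarrow> ereal) \<Rightarrow> bool" where
  "convex_fun h \<longleftrightarrow> convex (ext_epigraph h)"

definition strictly_convex_on :: "'a::real_vector set \<Rightarrow> ('a \<Rightarrow> real) \<Rightarrow> bool" where
  "strictly_convex_on S g \<longleftrightarrow> convex S \<and>
     (\<forall>x\<in>S. \<forall>y\<in>S. \<forall>t. x \<noteq> y \<and> 0 < t \<and> t < 1 \<longrightarrow>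
        g ((1 - t) *\<^sub>R x + t *\<^sub>R y) < (1 - t) * g x + t * g y)"

text \<open>The finite part of an extended-real-valued function. It is only meaningful on the
  effective domain, since \<^const>\<open>real_of_ereal\<close> sends both infinities to 0.\<close>

definition rpart :: "('a \<Rightarrow> ereal) \<Rightarrow> 'a \<Rightarrow> real" where
  "rpart h x = real_of_ereal (h x)"


section \<open>Gradient, Hessian and third derivative\<close>

definition gradient :: "('a::real_inner \<Rightarrow> real) \<Rightarrow> 'a \<Rightarrow> 'a" where
  "gradient g u = (THE d. GDERIV g u :> d)"

definition hessian :: "(real^'m \<Rightarrow> real) \<Rightarrow> real^'m \<Rightarrow> real^'m^'m" where
  "hessian g u = jacobian (gradient g) (at u)"

text \<open>The third derivative is the Frechet derivative of the matrix-valued Hessian map: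
  \<open>third_deriv g u w1 w2 w3\<close> is $D^3 g(u)[w_1, w_2, w_3]$.\<close>

definition third_deriv ::
    "(real^'m \<Rightarrow> real) \<Rightarrow> real^'m \<Rightarrow> real^'m \<Rightarrow> real^'m \<Rightarrow> real^'m \<Rightarrow> real" where
  "third_deriv g u w1 w2 w3 = (frechet_derivative (hessian g) (at u) w1 *v w2) \<bullet> w3"

definition three_times_differentiable_on_open :: "(real^'m) set \<Rightarrow> (real^'m \<Rightarrow> real) \<Rightarrow> bool" where
  "three_times_differentiable_on_open S g \<longleftrightarrow> open S \<and>
     (\<forall>u\<in>S. g differentiable (at u) \<and> gradient g differentiable (at u) \<and>
            hessian g differentiable (at u))"


section \<open>Regular cones and logarithmically homogeneous self-concordant barriers\<close>

definition regular_cone :: "'a::euclidean_space set \<Rightarrow> bool" where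
  "regular_cone K \<longleftrightarrow> cone K \<and> K \<noteq> UNIV \<and> closed K \<and> convex K \<and>
     \<not> (\<exists>p d. d \<noteq> 0 \<and> (\<forall>t::real. p + t *\<^sub>R d \<in> K)) \<and> interior K \<noteq> {}"

definition LHSCB :: "real \<Rightarrow> (real^'m) set \<Rightarrow> (real^'m \<Rightarrow> ereal) \<Rightarrow> bool" where
  "LHSCB \<theta> K f \<longleftrightarrow>
     proper_fun f \<and> convex_fun f \<and> edom f = interior K \<and>
     three_times_differentiable_on_open (interior K) (rpart f) \<and>
     strictly_convex_on (interior K) (rpart f) \<and>
     (\<forall>u\<in>interior K. \<forall>w.
        \<bar>third_deriv (rpart f) u w w w\<bar> \<le> 2 * ((hessian (rpart f) u *v w) \<bullet> w) powr (3/2)) \<and>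
     (\<forall>U u. (\<forall>k::nat. U k \<in> interior K) \<and> U \<longlonglongrightarrow> u \<and> u \<in> frontier K \<longrightarrow>
        (\<lambda>k. f (U k)) \<longlonglongrightarrow> \<infinity>) \<and>
     (\<forall>u\<in>interior K. \<forall>t>0. f (t *\<^sub>R u) = f u - ereal (\<theta> * ln t))"

definition local_norm :: "(real^'m \<Rightarrow> ereal) \<Rightarrow> real^'m \<Rightarrow> real^'m \<Rightarrow> real" where
  "local_norm f u w = sqrt (w \<bullet> (hessian (rpart f) u *v w))"


section \<open>The composite problem\<close>

definition objective ::
    "(real^'m \<Rightarrow> ereal) \<Rightarrow> (real^'n \<Rightarrow> real^'m) \<Rightarrow> (real^'n \<Rightarrow> ereal) \<Rightarrow> real^'n \<Rightarrow> ereal" where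
  "objective f A h x = f (A x) + h x"

definition opt_value ::
    "(real^'m \<Rightarrow> ereal) \<Rightarrow> (real^'n \<Rightarrow> real^'m) \<Rightarrow> (real^'n \<Rightarrow> ereal) \<Rightarrow> ereal" where
  "opt_value f A h = (INF x. objective f A h x)"

definition opt_gap ::
    "(real^'m \<Rightarrow> ereal) \<Rightarrow> (real^'n \<Rightarrow> real^'m) \<Rightarrow> (real^'n \<Rightarrow> ereal) \<Rightarrow> real^'n \<Rightarrow> real" where
  "opt_gap f A h x = real_of_ereal (objective f A h x - opt_value f A h)"

definition h_variations :: "('a \<Rightarrow> ereal) \<Rightarrow> real set" where
  "h_variations h = {\<bar>rpart h x - rpart h y\<bar> | x y. x \<in> edom h \<and> y \<in> edom h}"


section \<open>The generalized Frank-Wolfe method with adaptive step-size\<close>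

definition FW_subproblem ::
    "(real^'m \<Rightarrow> ereal) \<Rightarrow> (real^'n \<Rightarrow> real^'m) \<Rightarrow> (real^'n \<Rightarrow> ereal) \<Rightarrow> real^'n \<Rightarrow> real^'n \<Rightarrow> ereal" where
  "FW_subproblem f A h x y = ereal (gradient (rpart f) (A x) \<bullet> A y) + h y"

definition FW_gap ::
    "(real^'m \<Rightarrow> ereal) \<Rightarrow> (real^'n \<Rightarrow> real^'m) \<Rightarrow> (real^'n \<Rightarrow> ereal) \<Rightarrow> real^'n \<Rightarrow> real^'n \<Rightarrow> real" where
  "FW_gap f A h x v = gradient (rpart f) (A x) \<bullet> A (x - v) + rpart h x - rpart h v"

definition FW_dist ::
    "(real^'m \<Rightarrow> ereal) \<Rightarrow> (real^'n \<Rightarrow> real^'m) \<Rightarrow> real^'n \<Rightarrow> real^'n \<Rightarrow> real" where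
  "FW_dist f A x v = local_norm f (A x) (A (v - x))"

text \<open>For \<open>D = 0\<close> the quotient $G/(D(G+D))$ is read as $+\infty$, so the step is 1; HOL's
  convention \<open>G / 0 = 0\<close> would instead make the method stall.\<close>

definition FW_step :: "real \<Rightarrow> real \<Rightarrow> real" where
  "FW_step G D = (if D = 0 then 1 else min (G / (D * (G + D))) 1)"

text \<open>The minimizer \<open>v k\<close> need not be unique, so runs are described by a predicate on the
  sequences of iterates and of subproblem solutions.\<close>

definition FW_run ::
    "(real^'m \<Rightarrow> ereal) \<Rightarrow> (real^'n \<Rightarrow> real^'m) \<Rightarrow> (real^'n \<Rightarrow> ereal) \<Rightarrow>
     (nat \<Rightarrow> real^'n) \<Rightarrow> (nat \<Rightarrow> real^'n) \<Rightarrow> bool" where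
  "FW_run f A h x v \<longleftrightarrow>
     x 0 \<in> edom h \<inter> A -` edom f \<and>
     (\<forall>k. is_arg_min (FW_subproblem f A h (x k)) (\<lambda>_. True) (v k) \<and>
          x (Suc k) = x k +
            FW_step (FW_gap f A h (x k) (v k)) (FW_dist f A (x k) (v k)) *\<^sub>R (v k - x k))"

end

theory Submission
  imports Defs
begin

text \<open>
  Write \<open>c\<close> for \<open>\<theta> + R\<close>, \<open>g\<close> and \<open>H\<close> for the gradient and the Hessian of \<open>f\<close> at \<open>u = A x\<close>, and
  \<open>d = A (v - x)\<close>, so that \<open>D\<close> is the local norm of \<open>d\<close>.  Everything rests on two facts about one
  iteration, after which only the scalars \<open>\<delta> k\<close> and \<open>G k\<close> matter.

  The first fact is that the step size maximizes a guaranteed decrease.  Restricted to a line, the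
  second derivative \<open>q\<close> of a self-concordant function satisfies \<open>\<bar>q'\<bar> \<le> 2 q powr (3/2)\<close>, so
  \<open>1 / sqrt q\<close> is 1-Lipschitz.  Integrating twice gives
  \<open>f (u + d) \<le> f u + g \<bullet> d - D - ln (1 - D)\<close> whenever \<open>D < 1\<close> (\<open>upper_bound_within\<close>); as \<open>f\<close> blows up
  at the boundary, this bound also shows that \<open>u + d\<close> cannot reach it (\<open>dikin_interior\<close>).
  With the convexity of \<open>h\<close>, a step \<open>\<alpha>\<close> lowers the objective by at least
  \<open>\<alpha> G + \<alpha> D + ln (1 - \<alpha> D)\<close>.  The maximizer over \<open>\<alpha>\<close> is \<open>G / (D (G + D))\<close>, with value
  \<open>G / D - ln (1 + G / D)\<close>; if it exceeds 1, the full step still gains \<open>G / 2\<close>.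

  The second fact is \<open>D \<le> G + c\<close> (\<open>D_le\<close>): the method cannot be slowed down by a large local norm without
  the gap being large as well.  Logarithmic homogeneity gives \<open>g \<bullet> u = - \<theta>\<close> and \<open>H u = - g\<close>, and
  the Lipschitz property of \<open>1 / sqrt q\<close> along a ray inside the cone gives
  \<open>sqrt (H w \<bullet> w) \<le> - (g \<bullet> w)\<close> for \<open>w \<in> K\<close> (\<open>local_norm_le\<close>).  Expanding the square of the local norm
  of \<open>A v - A x\<close> with these identities bounds it by a quadratic in \<open>g \<bullet> A v\<close>, and \<open>- (g \<bullet> A v)\<close> is \<open>G\<close>
  up to \<open>\<theta>\<close> and a variation of \<open>h\<close>.

  Together, the decrease exceeds \<open>G / (5.3 (G + c))\<close> if \<open>G > c\<close> and is at least
  \<open>G\<^sup>2 / (12 c\<^sup>2)\<close> otherwise (\<open>FW_step_progress\<close>).  Since \<open>0 \<le> \<delta> \<le> G\<close>, the former is a geometric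
  decrease and also an absolute decrease by more than \<open>1 / 10.6\<close>, which bounds the number of such
  iterations; the latter makes \<open>1 / \<delta>\<close> grow by a constant.  For the number of iterations until
  \<open>G \<le> \<epsilon>\<close>, a concave potential of \<open>\<delta>\<close> (\<open>gap_potential\<close>) pays for every iteration with
  \<open>\<epsilon> < G \<le> c\<close>.
\<close>

section \<open>Estimates for the logarithm\<close>

text \<open>The constant 5.3 is a rounding of \<open>1 / (1 - 2 ln (3/2))\<close>, which is about 5.289; the
  claim is exactly that rounding. The sixteenth root of the exponential is small enough for the
  quadratic Taylor bound to be sharp enough.\<close>

lemma ln_three_halves_less: "ln (3/2 :: real) < 43/106"
proof -
  have "1 + 43/1696 + (43/1696)^2 / 2 \<le> exp (43/1696 :: real)"
    by (rule exp_lower_Taylor_quadratic) simp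
  then have "(1 + 43/1696 + (43/1696)^2 / 2) ^ 16 \<le> exp (43/1696 :: real) ^ 16"
    by (intro power_mono) auto
  also have "exp (43/1696 :: real) ^ 16 = exp (43/106)"
    by (simp flip: exp_of_nat_mult)
  finally have "3/2 < exp (43/106 :: real)"
    by (rule order.strict_trans2[rotated]) (simp add: power2_eq_square, simp add: eval_nat_numeral)
  then show ?thesis
    using ln_less_cancel_iff[of "3/2" "exp (43/106 :: real)"] by simp
qed

text \<open>The tangent of the logarithm at \<open>3/2\<close> reduces the claim to \<open>s = 1/2\<close>,
  where it is the numerical bound above.\<close>

lemma linear_less_diff_ln:
  fixes s :: real
  assumes "s \<ge> 1/2"
  shows "s / 5.3 < s - ln (1 + s)"
proof -
  define y where "y = (1 + s) / (3/2)"
  have y: "1 + s = 3/2 * y" "y > 0" using assms by (simp_all add: y_def)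
  have "ln (1 + s) = ln (3/2) + ln y"
    unfolding y(1) using y(2) by (intro ln_mult_pos) auto
  also have "\<dots> \<le> ln (3/2) + (y - 1)"
    using ln_le_minus_one[OF y(2)] by simp
  finally have "ln (1 + s) \<le> ln (3/2) + ((1 + s) / (3/2) - 1)"
    by (simp add: y_def)
  then show ?thesis
    using ln_three_halves_less assms by (simp add: field_simps)
qed

lemma square_le_diff_ln:
  fixes s :: real
  assumes "0 \<le> s" "s \<le> 1/2"
  shows "s\<^sup>2 / 3 \<le> s - ln (1 + s)"
proof -
  let ?p = "\<lambda>s::real. s - ln (1 + s) - s\<^sup>2 / 3"
  have "?p 0 \<le> ?p s"
  proof (rule DERIV_nonneg_imp_nondecreasing[OF assms(1)])
    fix t assume t: "0 \<le> t" "t \<le> s"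
    have "(?p has_real_derivative (1 - 1 / (1 + t) - 2 * t / 3)) (at t)"
      using t by (auto intro!: derivative_eq_intros)
    moreover have "1 - 1 / (1 + t) - 2 * t / 3 = t * (1 - 2 * t) / (3 * (1 + t))"
      using t by (simp add: field_simps)
    moreover have "0 \<le> t * (1 - 2 * t) / (3 * (1 + t))"
      using t assms by (intro divide_nonneg_nonneg mult_nonneg_nonneg) auto
    ultimately show "\<exists>y. (?p has_real_derivative y) (at t) \<and> 0 \<le> y"
      by (intro exI[where x = "1 - 1 / (1 + t) - 2 * t / 3"]) auto
  qed
  then show ?thesis by simp
qed

lemma ln_one_minus_lower:
  fixes D :: real
  assumes "0 \<le> D" "D < 1"
  shows "- D - ln (1 - D) \<le> D\<^sup>2 / (2 * (1 - D))"
proof -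
  let ?p = "\<lambda>D::real. D\<^sup>2 / (2 * (1 - D)) + D + ln (1 - D)"
  have "?p 0 \<le> ?p D"
  proof (rule DERIV_nonneg_imp_nondecreasing[OF assms(1)])
    fix t assume t: "0 \<le> t" "t \<le> D"
    then have t1: "1 - t > 0" using assms by simp
    have "(?p has_real_derivative
        ((2 * t * (2 * (1 - t)) - t\<^sup>2 * (- 2)) / (2 * (1 - t))\<^sup>2 + 1 + (- 1) / (1 - t))) (at t)"
      using t1 by (auto intro!: derivative_eq_intros simp: power2_eq_square)
    moreover have "(2 * t * (2 * (1 - t)) - t\<^sup>2 * (- 2)) / (2 * (1 - t))\<^sup>2 + 1 + (- 1) / (1 - t)
        = t\<^sup>2 / (2 * (1 - t)\<^sup>2)"
      using t1 by (simp add: power2_eq_square divide_simps) algebra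
    ultimately show "\<exists>y. (?p has_real_derivative y) (at t) \<and> 0 \<le> y"
      by (intro exI[where x = "t\<^sup>2 / (2 * (1 - t)\<^sup>2)"]) auto
  qed
  then show ?thesis by simp
qed

section \<open>The step size\<close>

text \<open>The step size is the maximizer of \<open>\<alpha> G + \<alpha> D + ln (1 - \<alpha> D)\<close> over \<open>\<alpha> \<le> 1\<close>. The
  unconstrained maximizer \<open>G / (D (G + D))\<close> has the value \<open>G / D - ln (1 + G / D)\<close>. When it is at
  least 1, then \<open>D\<^sup>2 \<le> G (1 - D)\<close>, so \<open>- D - ln (1 - D)\<close> uses up at most half of \<open>G\<close>.\<close>

lemma FW_step_cases:
  fixes G D :: real
  defines "\<alpha> \<equiv> FW_step G D"
  defines "dec \<equiv> \<alpha> * G + \<alpha> * D + ln (1 - \<alpha> * D)"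
  assumes G: "0 \<le> G" and D: "0 \<le> D"
  shows "0 \<le> \<alpha>" and "\<alpha> \<le> 1" and "\<alpha> * D < 1"
    and "G / 2 \<le> dec \<or> (0 < D \<and> dec = G / D - ln (1 + G / D))"
proof -
  define q where "q = G / (D * (G + D))"
  have "0 \<le> \<alpha> \<and> \<alpha> \<le> 1 \<and> \<alpha> * D < 1 \<and> (G / 2 \<le> dec \<or> (0 < D \<and> dec = G / D - ln (1 + G / D)))"
  proof (cases "D = 0")
    case True
    then show ?thesis using G by (simp add: \<alpha>_def dec_def FW_step_def)
  next
    case False
    then have D: "0 < D" using D by simp
    have q0: "0 \<le> q" using G D by (simp add: q_def)
    have \<alpha>: "\<alpha> = min q 1" using D by (simp add: \<alpha>_def FW_step_def q_def)
    show ?thesis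
    proof (cases "q < 1")
      case True
      then have \<alpha>: "\<alpha> = q" using \<alpha> by simp
      have qD: "q * D = G / (G + D)" using D by (simp add: q_def)
      have "1 - q * D = inverse (1 + G / D)"
        unfolding qD using D G by (simp add: field_simps)
      then have "ln (1 - q * D) = - ln (1 + G / D)"
        using D G by (simp add: ln_inverse add_pos_nonneg)
      moreover have "q * G + q * D = G / D"
        unfolding distrib_left[symmetric] using D G by (simp add: q_def)
      moreover have "q * D < 1"
        unfolding qD using D G by (simp add: field_simps)
      ultimately show ?thesis
        unfolding dec_def \<alpha> using q0 True D by simp
    next
      case False
      then have \<alpha>: "\<alpha> = 1" using \<alpha> by simp
      have le: "D * (G + D) \<le> G"
        using False D G unfolding q_def by (simp add: not_less pos_le_divide_eq)
      have D1: "D < 1"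
      proof (rule ccontr)
        assume "\<not> ?thesis"
        then have "1 * (G + D) \<le> D * (G + D)"
          using D G by (intro mult_right_mono) auto
        then show False using le D by simp
      qed
      have "D\<^sup>2 \<le> G * (1 - D)"
        using le by (simp add: algebra_simps power2_eq_square)
      then have "D\<^sup>2 / (2 * (1 - D)) \<le> G / 2"
        using D1 by (simp add: field_simps)
      moreover have "dec = G + D + ln (1 - D)" by (simp add: dec_def \<alpha>)
      ultimately have "G / 2 \<le> dec"
        using ln_one_minus_lower[of D] D D1 by linarith
      then show ?thesis using \<alpha> D1 by simp
    qed
  qed
  then show "0 \<le> \<alpha>" "\<alpha> \<le> 1" "\<alpha> * D < 1"
    "G / 2 \<le> dec \<or> (0 < D \<and> dec = G / D - ln (1 + G / D))" by auto
qed

text \<open>If \<open>D \<le> G + c\<close> and \<open>c < G\<close>, then \<open>G / D\<close> is at least \<open>1/2\<close>, where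
  \<open>s - ln (1 + s)\<close> is bounded below by a linear function. If \<open>G \<le> c\<close>, then \<open>D \<le> 2 c\<close>, and the quadratic lower bound for
  \<open>s \<le> 1/2\<close> applies, the range \<open>s > 1/2\<close> being covered by the linear one.\<close>

lemma FW_step_progress:
  fixes G D c :: real
  defines "\<alpha> \<equiv> FW_step G D"
  defines "dec \<equiv> \<alpha> * G + \<alpha> * D + ln (1 - \<alpha> * D)"
  assumes G: "0 \<le> G" and D: "0 \<le> D" and c: "1 \<le> c" and DG: "D \<le> G + c"
  shows "c < G \<Longrightarrow> G / (5.3 * (G + c)) < dec"
    and "G \<le> c \<Longrightarrow> G\<^sup>2 / (12 * c\<^sup>2) \<le> dec"
proof -
  consider "G / 2 \<le> dec" | "0 < D" "dec = G / D - ln (1 + G / D)"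
    using FW_step_cases(4)[OF G D] by (auto simp: dec_def \<alpha>_def)
  note cases = this
  show "G / (5.3 * (G + c)) < dec" if large: "c < G"
  proof (cases rule: cases)
    case 1
    have "G / (5.3 * (G + c)) < G / 2"
      using large c by (intro divide_strict_left_mono) auto
    then show ?thesis using 1 by simp
  next
    case 2
    have le: "G / (G + c) \<le> G / D"
      using 2 DG large c by (intro divide_left_mono) auto
    moreover have "1 / 2 \<le> G / (G + c)"
      using large c by (simp add: field_simps)
    ultimately have "1 / 2 \<le> G / D" by (rule order_trans[rotated])
    then have "G / D / 5.3 < dec"
      unfolding 2(2) by (rule linear_less_diff_ln)
    moreover have "G / (G + c) / 5.3 \<le> G / D / 5.3"
      using le by (rule divide_right_mono) simp
    ultimately have "G / (G + c) / 5.3 < dec" by (rule le_less_trans[rotated])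
    then show ?thesis by (simp add: mult.commute)
  qed
  show "G\<^sup>2 / (12 * c\<^sup>2) \<le> dec" if small: "G \<le> c"
  proof (cases rule: cases)
    case 1
    have "G * G \<le> G * (6 * c\<^sup>2)"
      using small c G self_le_power[of c 2] by (intro mult_left_mono) auto
    then have "G\<^sup>2 / (12 * c\<^sup>2) \<le> G / 2"
      using c by (simp add: field_simps power2_eq_square)
    then show ?thesis using 1 by simp
  next
    case 2
    show ?thesis
    proof (cases "G / D \<le> 1 / 2")
      case True
      have "G\<^sup>2 / (12 * c\<^sup>2) = (G / (2 * c))\<^sup>2 / 3"
        by (simp add: power_divide power_mult_distrib)
      also have "\<dots> \<le> (G / D)\<^sup>2 / 3"
        using 2 G DG small c
        by (intro divide_right_mono power_mono divide_left_mono) auto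
      also have "\<dots> \<le> dec"
        unfolding 2(2) using True 2 G by (intro square_le_diff_ln) auto
      finally show ?thesis .
    next
      case False
      then have "G / D / 5.3 < dec"
        unfolding 2(2) by (intro linear_less_diff_ln) simp
      moreover have "G\<^sup>2 / (12 * c\<^sup>2) \<le> 1 / 12"
        using power_mono[OF small G, of 2] c by (simp add: field_simps)
      ultimately show ?thesis using False by simp
    qed
  qed
qed

section \<open>Self-concordance along a line\<close>

text \<open>In terms of the second derivative \<open>q\<close>, self-concordance says that \<open>1 / sqrt q\<close>
  is 1-Lipschitz; the conclusions are this property, cleared of denominators so that they make
  sense when \<open>q\<close> vanishes. The function \<open>1 / sqrt (q + e)\<close> with \<open>e > 0\<close> is 1-Lipschitz for the
  same reason and everywhere defined, and \<open>e\<close> then tends to 0.\<close>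

lemma self_concordant_second_derivative:
  fixes q q' :: "real \<Rightarrow> real"
  assumes T: "0 \<le> T"
    and q: "\<And>t. 0 \<le> t \<Longrightarrow> t \<le> T \<Longrightarrow> (q has_real_derivative q' t) (at t)"
    and nonneg: "\<And>t. 0 \<le> t \<Longrightarrow> t \<le> T \<Longrightarrow> 0 \<le> q t"
    and sc: "\<And>t. 0 \<le> t \<Longrightarrow> t \<le> T \<Longrightarrow> \<bar>q' t\<bar> \<le> 2 * q t powr (3/2)"
  shows "sqrt (q T) * (1 - sqrt (q 0) * T) \<le> sqrt (q 0)"
    and "sqrt (q 0) \<le> sqrt (q T) * (1 + sqrt (q 0) * T)"
proof -
  have lip: "\<bar>inverse (sqrt (q T + e)) - inverse (sqrt (q 0 + e))\<bar> \<le> T" if e: "e > 0" for e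
  proof -
    define p where "p t = inverse (sqrt (q t + e))" for t
    define p' where "p' t = - q' t / (2 * sqrt (q t + e) ^ 3)" for t
    have p: "(p has_real_derivative p' t) (at t)" and p'_le: "\<bar>p' t\<bar> \<le> 1"
      if t: "0 \<le> t" "t \<le> T" for t
    proof -
      have pos: "q t + e > 0" using nonneg[OF t] e by simp
      show "(p has_real_derivative p' t) (at t)"
        unfolding p_def p'_def using pos
        by (auto intro!: derivative_eq_intros q[OF t] simp: power3_eq_cube divide_simps)
      have "\<bar>q' t\<bar> \<le> 2 * q t powr (3/2)" by (rule sc[OF t])
      also have "q t powr (3/2) \<le> (q t + e) powr (3/2)"
        using nonneg[OF t] e by (intro powr_mono2) auto
      also have "(q t + e) powr (3/2) = ((q t + e) powr (1/2)) powr 3"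
        by (simp add: powr_powr)
      also have "\<dots> = sqrt (q t + e) ^ 3"
        using pos by (simp add: powr_half_sqrt)
      finally show "\<bar>p' t\<bar> \<le> 1"
        unfolding p'_def using pos by (simp add: abs_mult)
    qed
    have "p 0 + 0 \<le> p T + T"
    proof (rule DERIV_nonneg_imp_nondecreasing[OF T, where f = "\<lambda>t. p t + t"])
      fix t assume t: "0 \<le> t" "t \<le> T"
      show "\<exists>y. ((\<lambda>t. p t + t) has_real_derivative y) (at t) \<and> 0 \<le> y"
        using p'_le[OF t] by (intro exI[where x = "p' t + 1"] conjI DERIV_add DERIV_ident p[OF t]) auto
    qed
    moreover have "0 - p 0 \<le> T - p T"
    proof (rule DERIV_nonneg_imp_nondecreasing[OF T, where f = "\<lambda>t. t - p t"])
      fix t assume t: "0 \<le> t" "t \<le> T"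
      show "\<exists>y. ((\<lambda>t. t - p t) has_real_derivative y) (at t) \<and> 0 \<le> y"
        using p'_le[OF t] by (intro exI[where x = "1 - p' t"] conjI DERIV_diff DERIV_ident p[OF t]) auto
    qed
    ultimately show ?thesis unfolding p_def by simp
  qed
  have lim: "((\<lambda>e. sqrt (q t + e)) \<longlongrightarrow> sqrt (q t)) (at_right 0)" for t
  proof -
    have "((\<lambda>e. sqrt (q t + e)) \<longlongrightarrow> sqrt (q t + 0)) (at_right 0)"
      by (intro tendsto_intros)
    then show ?thesis by simp
  qed
  have pos: "\<forall>\<^sub>F e in at_right 0. (0::real) < e"
    by (simp add: eventually_at_right_less)
  have reg: "sqrt (q T + e) * (1 - sqrt (q 0 + e) * T) \<le> sqrt (q 0 + e)"
            "sqrt (q 0 + e) \<le> sqrt (q T + e) * (1 + sqrt (q 0 + e) * T)" if e: "e > 0" for e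
  proof -
    have "sqrt (q T + e) > 0" "sqrt (q 0 + e) > 0"
      using nonneg[of T] nonneg[of 0] T e by auto
    then show "sqrt (q T + e) * (1 - sqrt (q 0 + e) * T) \<le> sqrt (q 0 + e)"
            "sqrt (q 0 + e) \<le> sqrt (q T + e) * (1 + sqrt (q 0 + e) * T)"
      using lip[OF e] by (auto simp: field_simps abs_le_iff)
  qed
  have "((\<lambda>e. sqrt (q T + e) * (1 - sqrt (q 0 + e) * T)) \<longlongrightarrow>
      sqrt (q T) * (1 - sqrt (q 0) * T)) (at_right 0)"
    by (intro tendsto_mult tendsto_diff tendsto_const lim)
  then show "sqrt (q T) * (1 - sqrt (q 0) * T) \<le> sqrt (q 0)"
    by (rule tendsto_le[OF trivial_limit_at_right_real lim[of 0]])
       (rule eventually_mono[OF pos], rule reg)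
  have "((\<lambda>e. sqrt (q T + e) * (1 + sqrt (q 0 + e) * T)) \<longlongrightarrow>
      sqrt (q T) * (1 + sqrt (q 0) * T)) (at_right 0)"
    by (intro tendsto_mult tendsto_add tendsto_const lim)
  then show "sqrt (q 0) \<le> sqrt (q T) * (1 + sqrt (q 0) * T)"
    by (rule tendsto_le[OF trivial_limit_at_right_real _ lim[of 0]])
       (rule eventually_mono[OF pos], rule reg)
qed

text \<open>Two comparisons of derivatives: by the bound on the second derivative \<open>q\<close>, the
  function on the right has a larger second derivative than \<open>p\<close>, and agrees with \<open>p\<close> to first order
  at 0.\<close>

lemma self_concordant_upper:
  fixes p p1 q q' :: "real \<Rightarrow> real"
  assumes T: "0 \<le> T"
    and p: "\<And>t. 0 \<le> t \<Longrightarrow> t \<le> T \<Longrightarrow> (p has_real_derivative p1 t) (at t)"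
    and p1: "\<And>t. 0 \<le> t \<Longrightarrow> t \<le> T \<Longrightarrow> (p1 has_real_derivative q t) (at t)"
    and q: "\<And>t. 0 \<le> t \<Longrightarrow> t \<le> T \<Longrightarrow> (q has_real_derivative q' t) (at t)"
    and nonneg: "\<And>t. 0 \<le> t \<Longrightarrow> t \<le> T \<Longrightarrow> 0 \<le> q t"
    and sc: "\<And>t. 0 \<le> t \<Longrightarrow> t \<le> T \<Longrightarrow> \<bar>q' t\<bar> \<le> 2 * q t powr (3/2)"
    and rT: "sqrt (q 0) * T < 1"
  shows "p T \<le> p 0 + T * p1 0 - sqrt (q 0) * T - ln (1 - sqrt (q 0) * T)"
proof -
  define r where "r = sqrt (q 0)"
  have r0: "r \<ge> 0" using nonneg[of 0] T by (simp add: r_def)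
  have lt: "1 - r * t > 0" if "0 \<le> t" "t \<le> T" for t
    using mult_left_mono[OF that(2) r0] rT by (simp add: r_def)
  have q_le: "q t \<le> r\<^sup>2 / (1 - r * t)\<^sup>2" if t: "0 \<le> t" "t \<le> T" for t
  proof -
    have "sqrt (q t) * (1 - r * t) \<le> r"
      unfolding r_def by (rule self_concordant_second_derivative(1)[where q' = q']) (use t q nonneg sc in auto)
    then have "(sqrt (q t) * (1 - r * t))\<^sup>2 \<le> r\<^sup>2"
      using lt[OF t] nonneg[OF t] by (intro power_mono) auto
    then have "q t * (1 - r * t)\<^sup>2 \<le> r\<^sup>2"
      using nonneg[OF t] by (simp add: power_mult_distrib)
    then show ?thesis
      using lt[OF t] by (simp add: pos_le_divide_eq)
  qed
  have p1_le: "p1 t \<le> p1 0 - r + r / (1 - r * t)" if t: "0 \<le> t" "t \<le> T" for t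
  proof -
    have "r / (1 - r * 0) - p1 0 \<le> r / (1 - r * t) - p1 t"
    proof (rule DERIV_nonneg_imp_nondecreasing[OF t(1), where f = "\<lambda>t. r / (1 - r * t) - p1 t"])
      fix s assume s: "0 \<le> s" "s \<le> t"
      then have s': "0 \<le> s" "s \<le> T" using t by auto
      have "((\<lambda>t. r / (1 - r * t) - p1 t) has_real_derivative r\<^sup>2 / (1 - r * s)\<^sup>2 - q s) (at s)"
        using lt[OF s'] by (auto intro!: derivative_eq_intros p1[OF s'] simp: power2_eq_square)
      then show "\<exists>y. ((\<lambda>t. r / (1 - r * t) - p1 t) has_real_derivative y) (at s) \<and> 0 \<le> y"
        using q_le[OF s'] by (intro exI[where x = "r\<^sup>2 / (1 - r * s)\<^sup>2 - q s"]) auto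
    qed
    then show ?thesis by simp
  qed
  let ?b = "\<lambda>t. t * p1 0 - r * t - ln (1 - r * t) - p t"
  have "?b 0 \<le> ?b T"
  proof (rule DERIV_nonneg_imp_nondecreasing[OF T])
    fix t assume t: "0 \<le> t" "t \<le> T"
    have "(?b has_real_derivative p1 0 - r + r / (1 - r * t) - p1 t) (at t)"
      using lt[OF t] by (auto intro!: derivative_eq_intros p[OF t])
    then show "\<exists>y. (?b has_real_derivative y) (at t) \<and> 0 \<le> y"
      using p1_le[OF t] by (intro exI[where x = "p1 0 - r + r / (1 - r * t) - p1 t"]) auto
  qed
  then show ?thesis by (simp add: r_def)
qed

text \<open>The lower bound \<open>r\<^sup>2 / (1 + r t)\<^sup>2\<close> for the second derivative, where \<open>r = sqrt (q 0)\<close>, has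
  integral \<open>r\<close> over the half-line. A first derivative \<open>p1\<close> that stays nonpositive must
  therefore start at \<open>- r\<close> or below.\<close>

lemma self_concordant_nonincreasing_ray:
  fixes p1 q q' :: "real \<Rightarrow> real"
  assumes p1: "\<And>t. 0 \<le> t \<Longrightarrow> (p1 has_real_derivative q t) (at t)"
    and q: "\<And>t. 0 \<le> t \<Longrightarrow> (q has_real_derivative q' t) (at t)"
    and nonneg: "\<And>t. 0 \<le> t \<Longrightarrow> 0 \<le> q t"
    and sc: "\<And>t. 0 \<le> t \<Longrightarrow> \<bar>q' t\<bar> \<le> 2 * q t powr (3/2)"
    and nonpos: "\<And>t. 0 \<le> t \<Longrightarrow> p1 t \<le> 0"
  shows "sqrt (q 0) \<le> - p1 0"
proof -
  define r where "r = sqrt (q 0)"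
  have r0: "r \<ge> 0" using nonneg[of 0] by (simp add: r_def)
  have pos: "1 + r * t > 0" if "0 \<le> t" for t
    using mult_nonneg_nonneg[OF r0 that] by simp
  have q_ge: "r\<^sup>2 / (1 + r * t)\<^sup>2 \<le> q t" if t: "0 \<le> t" for t
  proof -
    have "r \<le> sqrt (q t) * (1 + r * t)"
      unfolding r_def by (rule self_concordant_second_derivative(2)[where q' = q']) (use t q nonneg sc in auto)
    then have "r\<^sup>2 \<le> (sqrt (q t) * (1 + r * t))\<^sup>2"
      using r0 by (intro power_mono) auto
    then have "r\<^sup>2 \<le> q t * (1 + r * t)\<^sup>2"
      using nonneg[OF t] by (simp add: power_mult_distrib)
    then show ?thesis
      using pos[OF t] by (simp add: pos_divide_le_eq)
  qed
  have bound: "r - r / (1 + r * t) \<le> - p1 0" if t: "0 \<le> t" for t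
  proof -
    have "p1 0 + r / (1 + r * 0) \<le> p1 t + r / (1 + r * t)"
    proof (rule DERIV_nonneg_imp_nondecreasing[OF t, where f = "\<lambda>t. p1 t + r / (1 + r * t)"])
      fix s :: real assume s: "0 \<le> s"
      have "((\<lambda>t. p1 t + r / (1 + r * t)) has_real_derivative q s - r\<^sup>2 / (1 + r * s)\<^sup>2) (at s)"
        using pos[OF s] by (auto intro!: derivative_eq_intros p1[OF s] simp: power2_eq_square)
      then show "\<exists>y. ((\<lambda>t. p1 t + r / (1 + r * t)) has_real_derivative y) (at s) \<and> 0 \<le> y"
        using q_ge[OF s] by (intro exI[where x = "q s - r\<^sup>2 / (1 + r * s)\<^sup>2"]) auto
    qed
    then show ?thesis using nonpos[OF t] by simp
  qed
  show ?thesis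
  proof (cases "r = 0")
    case True
    then show ?thesis using nonpos[of 0] by (simp add: r_def)
  next
    case False
    then have "r > 0" using r0 by simp
    then have "((\<lambda>t. r - r / (1 + r * t)) \<longlongrightarrow> r - 0) at_top"
      by (intro tendsto_intros real_tendsto_divide_at_top[where c = r]
            filterlim_tendsto_add_at_top[OF tendsto_const]
            filterlim_tendsto_pos_mult_at_top[OF tendsto_const _ filterlim_ident]) auto
    then have "r - 0 \<le> - p1 0"
      by (rule tendsto_upperbound)
         (auto intro!: eventually_mono[OF eventually_ge_at_top[of 0]] bound)
    then show ?thesis by (simp add: r_def)
  qed
qed

section \<open>Logarithmically homogeneous self-concordant barriers\<close>

lemma GDERIV_gradient:
  fixes g :: "'a::euclidean_space \<Rightarrow> real"
  assumes "g differentiable (at u)"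
  shows "GDERIV g u :> gradient g u"
proof -
  obtain D where D: "(g has_derivative D) (at u)"
    using assms by (auto simp: differentiable_def)
  interpret D: bounded_linear D using D by (rule has_derivative_bounded_linear)
  have "D = (\<lambda>h. h \<bullet> (\<Sum>b\<in>Basis. D b *\<^sub>R b))"
  proof
    fix h
    have "D h = D (\<Sum>b\<in>Basis. (h \<bullet> b) *\<^sub>R b)" by (simp add: euclidean_representation)
    also have "\<dots> = h \<bullet> (\<Sum>b\<in>Basis. D b *\<^sub>R b)"
      by (simp add: D.sum D.scaleR inner_sum_right mult.commute)
    finally show "D h = h \<bullet> (\<Sum>b\<in>Basis. D b *\<^sub>R b)" .
  qed
  then have ex: "GDERIV g u :> (\<Sum>b\<in>Basis. D b *\<^sub>R b)"
    using D by (simp add: gderiv_def)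
  have "d = e" if "GDERIV g u :> d" "GDERIV g u :> e" for d e
  proof -
    have "(\<lambda>h. h \<bullet> d) = (\<lambda>h. h \<bullet> e)"
      using that unfolding gderiv_def by (rule has_derivative_unique)
    then have "h \<bullet> d = h \<bullet> e" for h by metis
    then show "d = e" by (metis inner_commute vector_eq_rdot)
  qed
  then show ?thesis
    unfolding gradient_def using ex by (rule_tac theI) auto
qed

locale lh_barrier =
  fixes \<theta> :: real and K :: "(real^'m) set" and f :: "real^'m \<Rightarrow> ereal"
  assumes regular: "regular_cone K" and theta: "1 \<le> \<theta>" and barrier: "LHSCB \<theta> K f"
begin

abbreviation g where "g \<equiv> gradient (rpart f)"
abbreviation H where "H \<equiv> hessian (rpart f)"

lemma edom_f: "edom f = interior K" and proper_f: "proper_fun f"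
  using barrier by (simp_all only: LHSCB_def)

lemma f_infinite: "u \<notin> interior K \<Longrightarrow> f u = \<infinity>"
  using edom_f by (auto simp: edom_def)

lemma f_finite:
  assumes "u \<in> interior K"
  shows "f u = ereal (rpart f u)"
proof -
  have "f u < \<infinity>" using assms edom_f by (auto simp: edom_def)
  moreover have "f u \<noteq> -\<infinity>" using proper_f by (simp add: proper_fun_def)
  ultimately show ?thesis by (cases "f u") (simp_all add: rpart_def)
qed

lemma f_scaled: "u \<in> interior K \<Longrightarrow> 0 < t \<Longrightarrow> f (t *\<^sub>R u) = f u - ereal (\<theta> * ln t)"
  using barrier by (simp only: LHSCB_def)

lemma strictly_convex_f: "strictly_convex_on (interior K) (rpart f)"
  using barrier by (simp only: LHSCB_def)

lemma f_blowup:
  "(\<And>k :: nat. U k \<in> interior K) \<Longrightarrow> U \<longlonglongrightarrow> u \<Longrightarrow> u \<in> frontier K \<Longrightarrow>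
    (\<lambda>k. f (U k)) \<longlonglongrightarrow> \<infinity>"
  using barrier unfolding LHSCB_def by metis

lemma scaled_interior:
  assumes "u \<in> interior K" "0 < t"
  shows "t *\<^sub>R u \<in> interior K" "rpart f (t *\<^sub>R u) = rpart f u - \<theta> * ln t"
proof -
  have eq: "f (t *\<^sub>R u) = ereal (rpart f u - \<theta> * ln t)"
    using f_scaled[OF assms] f_finite[OF assms(1)] by simp
  then show "t *\<^sub>R u \<in> interior K" using f_infinite by fastforce
  show "rpart f (t *\<^sub>R u) = rpart f u - \<theta> * ln t"
    unfolding rpart_def[of _ "t *\<^sub>R u"] eq by simp
qed

lemma closed_K: "closed K" and convex_K: "convex K" and cone_K: "cone K"
  using regular by (simp_all only: regular_cone_def)

text \<open>Scaling by 2 writes \<open>u + t w\<close> as the midpoint of an interior point and a point of \<open>K\<close>.\<close>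

lemma ray_interior:
  assumes u: "u \<in> interior K" and w: "w \<in> K" and t: "0 \<le> t"
  shows "u + t *\<^sub>R w \<in> interior K"
proof -
  have "(2 * t) *\<^sub>R w \<in> K" using cone_K w t by (simp add: cone_def)
  moreover have "2 *\<^sub>R u \<in> interior K" by (rule scaled_interior(1)[OF u]) simp
  ultimately have "(2 * t) *\<^sub>R w - (1/2) *\<^sub>R ((2 * t) *\<^sub>R w - 2 *\<^sub>R u) \<in> interior K"
    using convex_K by (intro mem_interior_convex_shrink) auto
  also have "(2 * t) *\<^sub>R w - (1/2) *\<^sub>R ((2 * t) *\<^sub>R w - 2 *\<^sub>R u) = u + t *\<^sub>R w"
    by (simp add: algebra_simps flip: scaleR_add_left)
  finally show ?thesis .
qed

lemma segment_interior:
  assumes u: "u \<in> interior K" and w: "u + d \<in> K" and t: "0 \<le> t" "t < 1"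
  shows "u + t *\<^sub>R d \<in> interior K"
proof -
  have "(u + d) - (1 - t) *\<^sub>R ((u + d) - u) \<in> interior K"
    using mem_interior_convex_shrink[OF convex_K u w, of "1 - t"] t by simp
  also have "(u + d) - (1 - t) *\<^sub>R ((u + d) - u) = u + t *\<^sub>R d"
    by (simp add: scaleR_left_diff_distrib)
  finally show ?thesis .
qed

lemma smooth:
  assumes "u \<in> interior K"
  shows "rpart f differentiable (at u)" "g differentiable (at u)" "H differentiable (at u)"
  using barrier assms by (simp_all only: LHSCB_def three_times_differentiable_on_open_def)

lemma has_derivative_f: "u \<in> interior K \<Longrightarrow> (rpart f has_derivative (\<lambda>w. w \<bullet> g u)) (at u)"
  using GDERIV_gradient[OF smooth(1)] by (simp only: gderiv_def)

lemma has_derivative_g: "u \<in> interior K \<Longrightarrow> (g has_derivative (\<lambda>w. H u *v w)) (at u)"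
  using smooth(2) by (simp only: hessian_def jacobian_works)

lemma has_derivative_H:
  "u \<in> interior K \<Longrightarrow> (H has_derivative (frechet_derivative H (at u))) (at u)"
  using smooth(3) by (simp only: frechet_derivative_works)

lemma has_derivative_line: "((\<lambda>t. u + t *\<^sub>R d) has_derivative (\<lambda>s. s *\<^sub>R d)) (at t)"
  by (auto intro!: derivative_eq_intros)

lemma DERIV_f_line:
  assumes "u + t *\<^sub>R d \<in> interior K"
  shows "((\<lambda>t. rpart f (u + t *\<^sub>R d)) has_real_derivative g (u + t *\<^sub>R d) \<bullet> d) (at t)"
  using has_derivative_compose[OF has_derivative_line has_derivative_f[OF assms]]
  by (simp add: has_field_derivative_def inner_commute mult_commute_abs)

lemma DERIV_g_line:
  assumes "u + t *\<^sub>R d \<in> interior K"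
  shows "((\<lambda>t. g (u + t *\<^sub>R d) \<bullet> e) has_real_derivative (H (u + t *\<^sub>R d) *v d) \<bullet> e) (at t)"
  using has_derivative_inner_left[OF has_derivative_compose[OF has_derivative_line
      has_derivative_g[OF assms]], of e]
  by (simp add: has_field_derivative_def matrix_vector_mult_scaleR mult_commute_abs)

lemma DERIV_H_line:
  assumes "u + t *\<^sub>R d \<in> interior K"
  shows "((\<lambda>t. (H (u + t *\<^sub>R d) *v d) \<bullet> d) has_real_derivative
    third_deriv (rpart f) (u + t *\<^sub>R d) d d d) (at t)"
proof -
  have lin: "linear (\<lambda>M :: real^'m^'m. (M *v d) \<bullet> d)"
    by (intro linearI) (simp_all add: matrix_vector_mult_add_rdistrib inner_add_left
        flip: scaleR_matrix_vector_assoc)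
  interpret D: bounded_linear "frechet_derivative H (at (u + t *\<^sub>R d))"
    using has_derivative_H[OF assms] by (rule has_derivative_bounded_linear)
  have "((\<lambda>t. (H (u + t *\<^sub>R d) *v d) \<bullet> d) has_derivative
      (\<lambda>s. (frechet_derivative H (at (u + t *\<^sub>R d)) (s *\<^sub>R d) *v d) \<bullet> d)) (at t)"
    using bounded_linear.has_derivative[OF linear_conv_bounded_linear[THEN iffD1, OF lin]
        has_derivative_compose[OF has_derivative_line has_derivative_H[OF assms]]] .
  then show ?thesis
    by (simp add: has_field_derivative_def third_deriv_def D.scaleR mult_commute_abs
        flip: scaleR_matrix_vector_assoc)
qed

text \<open>The difference quotient of \<open>f\<close> along the segment is bounded by its value
  at \<open>t = 1\<close>, and \<open>t\<close> tends to 0 from the right.\<close>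

lemma gradient_inequality:
  assumes x: "x \<in> interior K" and y: "y \<in> interior K"
  shows "rpart f x + g x \<bullet> (y - x) \<le> rpart f y"
proof -
  let ?p = "\<lambda>t. rpart f (x + t *\<^sub>R (y - x))"
  have seg: "?p t \<le> (1 - t) * rpart f x + t * rpart f y" if "0 < t" "t < 1" for t
  proof (cases "x = y")
    case False
    have "x + t *\<^sub>R (y - x) = (1 - t) *\<^sub>R x + t *\<^sub>R y" by (simp add: algebra_simps)
    moreover have "rpart f ((1 - t) *\<^sub>R x + t *\<^sub>R y) < (1 - t) * rpart f x + t * rpart f y"
      using strictly_convex_f x y that False unfolding strictly_convex_on_def by blast
    ultimately show ?thesis by simp
  qed (simp add: algebra_simps)
  have "(?p has_real_derivative g x \<bullet> (y - x)) (at 0)"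
    using DERIV_f_line[of x 0 "y - x"] x by simp
  then have "((\<lambda>t. (?p t - rpart f x) / t) \<longlongrightarrow> g x \<bullet> (y - x)) (at_right 0)"
    by (simp add: has_field_derivative_iff filterlim_at_split)
  then have "g x \<bullet> (y - x) \<le> rpart f y - rpart f x"
  proof (rule tendsto_upperbound)
    have "\<forall>\<^sub>F t in at_right 0. t \<in> {0<..<1::real}"
      by (rule eventually_at_right_real) simp
    then show "\<forall>\<^sub>F t in at_right 0. (?p t - rpart f x) / t \<le> rpart f y - rpart f x"
    proof eventually_elim
      case (elim t)
      then show ?case using seg[of t] by (simp add: field_simps)
    qed
  qed simp
  then show ?thesis by simp
qed

lemma gradient_monotone:
  assumes "x \<in> interior K" "y \<in> interior K"
  shows "0 \<le> (g y - g x) \<bullet> (y - x)"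
  using gradient_inequality[OF assms] gradient_inequality[OF assms(2,1)]
  by (simp add: inner_diff_left inner_diff_right)

lemma hessian_nonneg:
  assumes u: "u \<in> interior K"
  shows "0 \<le> (H u *v w) \<bullet> w"
proof -
  have "((\<lambda>t. g (u + t *\<^sub>R w) \<bullet> w) has_real_derivative (H u *v w) \<bullet> w) (at 0)"
    using DERIV_g_line[of u 0 w w] u by simp
  then have "((\<lambda>t. (g (u + t *\<^sub>R w) \<bullet> w - g u \<bullet> w) / t) \<longlongrightarrow> (H u *v w) \<bullet> w) (at_right 0)"
    by (simp add: has_field_derivative_iff filterlim_at_split)
  then show ?thesis
  proof (rule tendsto_lowerbound)
    have "((\<lambda>t. u + t *\<^sub>R w) \<longlongrightarrow> u + 0 *\<^sub>R w) (at_right 0)"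
      by (intro tendsto_intros)
    then have "\<forall>\<^sub>F t in at_right 0. u + t *\<^sub>R w \<in> interior K"
      using u by (intro topological_tendstoD) auto
    moreover have "\<forall>\<^sub>F t in at_right 0. (0::real) < t"
      by (rule eventually_at_right_less)
    ultimately show "\<forall>\<^sub>F t in at_right 0. 0 \<le> (g (u + t *\<^sub>R w) \<bullet> w - g u \<bullet> w) / t"
    proof eventually_elim
      case (elim t)
      have "0 \<le> t * ((g (u + t *\<^sub>R w) - g u) \<bullet> w)"
        using gradient_monotone[OF u elim(1)] by simp
      then have "0 \<le> (g (u + t *\<^sub>R w) - g u) \<bullet> w"
        using elim(2) by (simp add: zero_le_mult_iff)
      then show ?case using elim(2) by (simp add: inner_diff_left)
    qed
  qed simp
qed

lemma self_concordant:
  "u \<in> interior K \<Longrightarrow> \<bar>third_deriv (rpart f) u w w w\<bar> \<le> 2 * ((H u *v w) \<bullet> w) powr (3/2)"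
  using barrier by (simp only: LHSCB_def)

lemma local_norm_alt: "local_norm f u w = sqrt ((H u *v w) \<bullet> w)"
  by (simp add: local_norm_def inner_commute)

lemma local_norm_nonneg: "u \<in> interior K \<Longrightarrow> 0 \<le> local_norm f u w"
  by (simp add: local_norm_alt hessian_nonneg)

lemma local_norm_scale: "0 \<le> t \<Longrightarrow> local_norm f u (t *\<^sub>R w) = t * local_norm f u w"
  by (simp add: local_norm_alt matrix_vector_mult_scaleR real_sqrt_mult)

lemma gradient_homogeneous:
  assumes u: "u \<in> interior K" and t: "0 < t"
  shows "t *\<^sub>R g (t *\<^sub>R u) = g u"
proof -
  have "((\<lambda>w. rpart f (t *\<^sub>R w)) has_derivative (\<lambda>w. (t *\<^sub>R w) \<bullet> g (t *\<^sub>R u))) (at u)"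
    by (rule has_derivative_compose[where f = "\<lambda>w. t *\<^sub>R w",
          OF _ has_derivative_f[OF scaled_interior(1)[OF u t]]])
       (auto intro!: derivative_eq_intros)
  moreover have "((\<lambda>w. rpart f (t *\<^sub>R w)) has_derivative (\<lambda>w. w \<bullet> g u)) (at u)"
  proof (rule has_derivative_transform_within_open[OF _ open_interior u])
    show "((\<lambda>w. rpart f w - \<theta> * ln t) has_derivative (\<lambda>w. w \<bullet> g u)) (at u)"
      using has_derivative_diff[OF has_derivative_f[OF u] has_derivative_const] by simp
  qed (simp add: scaled_interior t)
  ultimately have "(\<lambda>w. (t *\<^sub>R w) \<bullet> g (t *\<^sub>R u)) = (\<lambda>w. w \<bullet> g u)"
    by (rule has_derivative_unique)
  from fun_cong[OF this] have "w \<bullet> (t *\<^sub>R g (t *\<^sub>R u)) = w \<bullet> g u" for w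
    by simp
  then show ?thesis by (rule vector_eq_ldot[THEN iffD1, OF allI])
qed

text \<open>The derivative at \<open>t = 0\<close> of \<open>f ((1 + t) u) = f u - \<theta> ln (1 + t)\<close>.\<close>

lemma gradient_inner_self:
  assumes u: "u \<in> interior K"
  shows "g u \<bullet> u = - \<theta>"
proof -
  have "((\<lambda>t. rpart f (u + t *\<^sub>R u)) has_real_derivative g u \<bullet> u) (at 0)"
    using DERIV_f_line[of u 0 u] u by simp
  moreover have "((\<lambda>t. rpart f (u + t *\<^sub>R u)) has_real_derivative - \<theta>) (at 0)"
  proof (rule has_field_derivative_transform_within_open[where S = "{-1<..}"])
    show "((\<lambda>t. rpart f u - \<theta> * ln (1 + t)) has_real_derivative - \<theta>) (at 0)"
      by (auto intro!: derivative_eq_intros)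
    fix t :: real assume "t \<in> {-1<..}"
    then show "rpart f u - \<theta> * ln (1 + t) = rpart f (u + t *\<^sub>R u)"
      using scaled_interior(2)[OF u, of "1 + t"] by (simp add: scaleR_add_left)
  qed auto
  ultimately show ?thesis by (rule DERIV_unique)
qed

text \<open>The derivative at \<open>t = 0\<close> of \<open>g ((1 + t) u) = g u / (1 + t)\<close>.\<close>

lemma hessian_self:
  assumes u: "u \<in> interior K"
  shows "H u *v u = - g u"
proof -
  have "(H u *v u) \<bullet> e = (- g u) \<bullet> e" for e
  proof -
    have "((\<lambda>t. g (u + t *\<^sub>R u) \<bullet> e) has_real_derivative (H u *v u) \<bullet> e) (at 0)"
      using DERIV_g_line[of u 0 u e] u by simp
    moreover have "((\<lambda>t. g (u + t *\<^sub>R u) \<bullet> e) has_real_derivative - (g u \<bullet> e)) (at 0)"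
    proof (rule has_field_derivative_transform_within_open[where S = "{-1<..}"])
      show "((\<lambda>t. (g u \<bullet> e) / (1 + t)) has_real_derivative - (g u \<bullet> e)) (at 0)"
        by (auto intro!: derivative_eq_intros)
      fix t :: real assume t: "t \<in> {-1<..}"
      have "(1 + t) *\<^sub>R g (u + t *\<^sub>R u) = g u"
        using gradient_homogeneous[OF u, of "1 + t"] t by (simp add: scaleR_add_left)
      then have "(1 + t) * (g (u + t *\<^sub>R u) \<bullet> e) = g u \<bullet> e"
        by (metis inner_scaleR_left)
      then show "(g u \<bullet> e) / (1 + t) = g (u + t *\<^sub>R u) \<bullet> e"
        using t by (simp add: field_simps)
    qed auto
    ultimately have "(H u *v u) \<bullet> e = - (g u \<bullet> e)" by (rule DERIV_unique)
    then show ?thesis by simp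
  qed
  then show ?thesis by (rule vector_eq_rdot[THEN iffD1, OF allI])
qed

text \<open>The derivative of the identity \<open>g v \<bullet> v = - \<theta>\<close> at \<open>u\<close> in the direction \<open>w\<close>.\<close>

lemma hessian_inner_self:
  assumes u: "u \<in> interior K"
  shows "(H u *v w) \<bullet> u = - (g u \<bullet> w)"
proof -
  have "((\<lambda>v. g v \<bullet> v) has_derivative (\<lambda>w. g u \<bullet> w + (H u *v w) \<bullet> u)) (at u)"
    using has_derivative_inner[OF has_derivative_g[OF u] has_derivative_ident] .
  moreover have "((\<lambda>v. g v \<bullet> v) has_derivative (\<lambda>w. 0)) (at u)"
    by (rule has_derivative_transform_within_open[OF has_derivative_const[of "- \<theta>"] open_interior u])
       (simp add: gradient_inner_self)
  ultimately have "(\<lambda>w. g u \<bullet> w + (H u *v w) \<bullet> u) = (\<lambda>w. 0)"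
    by (rule has_derivative_unique)
  from fun_cong[OF this, of w] show ?thesis by simp
qed

text \<open>If the slope \<open>g u \<bullet> w\<close> were positive, the gradient inequality would force linear
  growth of \<open>f (s w)\<close> in \<open>s\<close>, whereas homogeneity makes it decrease logarithmically. Boundary points
  are limits of the interior points \<open>w + t u\<close>.\<close>

lemma gradient_nonpos:
  assumes u: "u \<in> interior K" and w: "w \<in> K"
  shows "g u \<bullet> w \<le> 0"
proof -
  have int: "g u \<bullet> w \<le> 0" if w: "w \<in> interior K" for w
  proof (rule ccontr)
    assume "\<not> ?thesis"
    then have pos: "0 < g u \<bullet> w" by simp
    define C where "C = rpart f w - rpart f u - \<theta>"
    have le: "s * (g u \<bullet> w) + \<theta> * ln s \<le> C" if "0 < s" for s
      using gradient_inequality[OF u scaled_interior(1)[OF w that]] scaled_interior(2)[OF w that]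
        gradient_inner_self[OF u]
      by (simp add: C_def inner_diff_right)
    \<comment> \<open>At this \<open>s\<close> the linear term exceeds \<open>C\<close>, while the logarithmic term is nonnegative.\<close>
    define s where "s = max 1 ((C + 1) / (g u \<bullet> w))"
    have "s \<ge> 1" "s * (g u \<bullet> w) \<ge> C + 1"
      using pos by (auto simp: s_def max_def field_simps)
    then show False using le[of s] mult_nonneg_nonneg[of \<theta> "ln s"] theta ln_ge_zero[of s] by linarith
  qed
  have "((\<lambda>t. g u \<bullet> (w + t *\<^sub>R u)) \<longlongrightarrow> g u \<bullet> (w + 0 *\<^sub>R u)) (at_right 0)"
    by (intro tendsto_intros)
  then have "g u \<bullet> (w + 0 *\<^sub>R u) \<le> 0"
  proof (rule tendsto_upperbound)
    show "\<forall>\<^sub>F t in at_right 0. g u \<bullet> (w + t *\<^sub>R u) \<le> 0"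
    proof (rule eventually_mono[OF eventually_at_right_less])
      fix t :: real assume "0 < t"
      then show "g u \<bullet> (w + t *\<^sub>R u) \<le> 0"
        using ray_interior[OF scaled_interior(1)[OF u, of t] w, of 1]
        by (intro int) (simp add: add.commute)
    qed
  qed simp
  then show ?thesis by simp
qed

text \<open>The ray from \<open>u\<close> in a direction \<open>w \<in> K\<close> never leaves the interior, and \<open>f\<close> does
  not increase along it.\<close>

lemma local_norm_le:
  assumes u: "u \<in> interior K" and w: "w \<in> K"
  shows "local_norm f u w \<le> - (g u \<bullet> w)"
proof -
  have ray: "u + t *\<^sub>R w \<in> interior K" if "0 \<le> t" for t by (rule ray_interior[OF u w that])
  have "sqrt ((H (u + 0 *\<^sub>R w) *v w) \<bullet> w) \<le> - (g (u + 0 *\<^sub>R w) \<bullet> w)"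
    using self_concordant_nonincreasing_ray[OF DERIV_g_line[OF ray] DERIV_H_line[OF ray]
        hessian_nonneg[OF ray] self_concordant[OF ray] gradient_nonpos[OF ray w]] .
  then show ?thesis by (simp add: local_norm_alt)
qed

text \<open>Expanding \<open>H (w - u) \<bullet> (w - u)\<close>: both mixed terms equal \<open>- (g u \<bullet> w)\<close> and the
  term in \<open>u\<close> is \<open>\<theta>\<close>, so that only \<open>H w \<bullet> w\<close> remains to be estimated.\<close>

lemma local_norm_chord:
  assumes u: "u \<in> interior K" and w: "w \<in> K"
  shows "(local_norm f u (w - u))\<^sup>2 \<le> (g u \<bullet> w)\<^sup>2 + 2 * (g u \<bullet> w) + \<theta>"
proof -
  have "(local_norm f u (w - u))\<^sup>2 = (H u *v w) \<bullet> w + 2 * (g u \<bullet> w) + \<theta>"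
    using hessian_nonneg[OF u, of "w - u"] hessian_inner_self[OF u, of w]
      hessian_self[OF u] gradient_inner_self[OF u]
    by (simp add: local_norm_alt matrix_vector_mult_diff_distrib inner_diff_left inner_diff_right
        inner_add_left)
  also have "(H u *v w) \<bullet> w = (local_norm f u w)\<^sup>2"
    using hessian_nonneg[OF u, of w] by (simp add: local_norm_alt)
  also have "(local_norm f u w)\<^sup>2 \<le> (- (g u \<bullet> w))\<^sup>2"
    using local_norm_le[OF u w] local_norm_nonneg[OF u] by (intro power_mono) auto
  finally show ?thesis by simp
qed

lemma upper_bound_within:
  assumes u: "u \<in> interior K" and d: "u + d \<in> interior K" and D: "local_norm f u d < 1"
  shows "rpart f (u + d) \<le> rpart f u + g u \<bullet> d - local_norm f u d - ln (1 - local_norm f u d)"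
proof -
  have seg: "u + t *\<^sub>R d \<in> interior K" if t: "0 \<le> t" "t \<le> 1" for t
  proof (cases "t < 1")
    case True
    have "u + d \<in> K" using d interior_subset by (rule subsetD[rotated])
    then show ?thesis by (rule segment_interior[OF u _ t(1) True])
  next
    case False
    then have "t = 1" using t(2) by linarith
    then show ?thesis using d by (simp only: scaleR_one)
  qed
  have "rpart f (u + 1 *\<^sub>R d) \<le> rpart f (u + 0 *\<^sub>R d) + 1 * (g (u + 0 *\<^sub>R d) \<bullet> d)
      - sqrt ((H (u + 0 *\<^sub>R d) *v d) \<bullet> d) * 1 - ln (1 - sqrt ((H (u + 0 *\<^sub>R d) *v d) \<bullet> d) * 1)"
    by (rule self_concordant_upper[OF zero_le_one DERIV_f_line[OF seg] DERIV_g_line[OF seg]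
          DERIV_H_line[OF seg] hessian_nonneg[OF seg] self_concordant[OF seg]])
        (use D in \<open>simp_all add: local_norm_alt\<close>)
  then show ?thesis by (simp add: local_norm_alt)
qed

text \<open>The points \<open>u + s d\<close> with \<open>s < 1\<close> are interior, and the upper bound on \<open>f\<close> is uniform on
  them because \<open>local_norm f u d < 1\<close>. An end point on the boundary would contradict the blow-up of
  the barrier. This covers the full step of the method, for which interpolation between an interior
  point and a point of the cone is not enough.\<close>

lemma dikin_interior:
  assumes u: "u \<in> interior K" and d: "u + d \<in> K" and D: "local_norm f u d < 1"
  shows "u + d \<in> interior K"
proof (rule ccontr)
  assume "u + d \<notin> interior K"
  then have fr: "u + d \<in> frontier K" using d closed_K by (simp add: frontier_def)
  define D where "D = local_norm f u d"
  have D01: "0 \<le> D" "D < 1" using D local_norm_nonneg[OF u] by (simp_all add: D_def)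
  define s where "s k = 1 - 1 / real (Suc k)" for k
  have s01: "0 \<le> s k" "s k < 1" for k by (auto simp: s_def)
  have "s \<longlonglongrightarrow> 1 - 0"
    unfolding s_def by (intro tendsto_intros LIMSEQ_inverse_real_of_nat[unfolded inverse_eq_divide])
  then have "(\<lambda>k. u + s k *\<^sub>R d) \<longlonglongrightarrow> u + (1 - 0) *\<^sub>R d"
    by (intro tendsto_intros)
  moreover have seg: "u + s k *\<^sub>R d \<in> interior K" for k
    using segment_interior[OF u d s01] .
  ultimately have "(\<lambda>k. f (u + s k *\<^sub>R d)) \<longlonglongrightarrow> \<infinity>"
    using fr by (intro f_blowup[where u = "u + d"]) simp_all
  moreover define C where "C = rpart f u + \<bar>g u \<bullet> d\<bar> - ln (1 - D)"
  have "f (u + s k *\<^sub>R d) \<le> ereal C" for k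
  proof -
    have sD: "0 \<le> s k * D" "s k * D \<le> D"
      using s01[of k] D01 by (simp_all add: mult_left_le_one_le)
    have "rpart f (u + s k *\<^sub>R d)
        \<le> rpart f u + s k * (g u \<bullet> d) - s k * D - ln (1 - s k * D)"
      using upper_bound_within[OF u seg[of k]] local_norm_scale[OF s01(1)] sD D01 by (simp add: D_def)
    moreover have "s k * (g u \<bullet> d) \<le> \<bar>g u \<bullet> d\<bar>"
      using mult_left_mono[OF abs_ge_self s01(1)]
        mult_left_le_one_le[OF abs_ge_zero s01(1) less_imp_le[OF s01(2)]]
      by (rule order_trans)
    moreover have "ln (1 - D) \<le> ln (1 - s k * D)"
      using sD D01 by simp
    ultimately have "rpart f (u + s k *\<^sub>R d) \<le> C" using sD unfolding C_def by linarith
    then show ?thesis using f_finite[OF seg] by simp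
  qed
  ultimately have "\<infinity> \<le> ereal C" by (intro LIMSEQ_le_const2) auto
  then show False by simp
qed

end

section \<open>One iteration of the generalized Frank-Wolfe method\<close>

lemma finite_value:
  assumes "proper_fun h" "y \<in> edom h"
  shows "h y = ereal (rpart h y)"
proof -
  have "h y < \<infinity>" using assms(2) by (simp add: edom_def)
  moreover have "h y \<noteq> -\<infinity>" using assms(1) by (simp add: proper_fun_def)
  ultimately show ?thesis by (cases "h y") (simp_all add: rpart_def)
qed

lemma convex_fun_segment:
  assumes h: "proper_fun h" "convex_fun h" and y: "y \<in> edom h" and z: "z \<in> edom h"
    and t: "0 \<le> t" "t \<le> 1"
  shows "y + t *\<^sub>R (z - y) \<in> edom h"
    and "rpart h (y + t *\<^sub>R (z - y)) \<le> rpart h y - t * (rpart h y - rpart h z)"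
proof -
  have "(y, rpart h y) \<in> ext_epigraph h" "(z, rpart h z) \<in> ext_epigraph h"
    using finite_value[OF h(1) y] finite_value[OF h(1) z] by (simp_all add: ext_epigraph_def)
  then have "(1 - t) *\<^sub>R (y, rpart h y) + t *\<^sub>R (z, rpart h z) \<in> ext_epigraph h"
    using h(2) t unfolding convex_fun_def by (intro convexD) auto
  then have le: "h (y + t *\<^sub>R (z - y)) \<le> ereal (rpart h y - t * (rpart h y - rpart h z))"
    by (simp add: ext_epigraph_def algebra_simps)
  then show edom: "y + t *\<^sub>R (z - y) \<in> edom h"
    unfolding edom_def using le_less_trans by fastforce
  show "rpart h (y + t *\<^sub>R (z - y)) \<le> rpart h y - t * (rpart h y - rpart h z)"
    using le unfolding finite_value[OF h(1) edom] by simp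
qed

text \<open>One iteration is isolated because the feasibility of the new point \<open>y'\<close> is among its
  conclusions: that all iterates are feasible follows from it by induction.\<close>

locale frank_wolfe_step = lh_barrier \<theta> K f
  for \<theta> :: real and K :: "(real^'m) set" and f :: "real^'m \<Rightarrow> ereal" +
  fixes A :: "real^'n \<Rightarrow> real^'m" and h :: "real^'n \<Rightarrow> ereal" and R :: real
    and y v :: "real^'n"
  assumes lin: "linear A"
    and h: "proper_fun h" "convex_fun h"
    and dom_in_cone: "A ` edom h \<subseteq> K"
    and variation: "\<And>y z. y \<in> edom h \<Longrightarrow> z \<in> edom h \<Longrightarrow> rpart h y - rpart h z \<le> R"
    and y_dom: "y \<in> edom h" and y_int: "A y \<in> interior K"
    and v_min: "is_arg_min (FW_subproblem f A h y) (\<lambda>_. True) v"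
begin

abbreviation "G \<equiv> FW_gap f A h y v"
abbreviation "D \<equiv> FW_dist f A y v"
abbreviation "\<alpha> \<equiv> FW_step G D"
abbreviation "y' \<equiv> y + \<alpha> *\<^sub>R (v - y)"
abbreviation "F z \<equiv> rpart f (A z) + rpart h z"
abbreviation "Fs \<equiv> real_of_ereal (opt_value f A h)"

lemma subproblem_le:
  assumes "z \<in> edom h"
  shows "FW_subproblem f A h y v \<le> ereal (g (A y) \<bullet> A z + rpart h z)"
  using v_min finite_value[OF h(1) assms]
  by (auto simp: is_arg_min_def FW_subproblem_def not_less dest: spec[where x = z])

lemma v_dom: "v \<in> edom h"
  using subproblem_le[OF y_dom] unfolding FW_subproblem_def edom_def by (cases "h v") auto

lemma v_optimal:
  assumes "z \<in> edom h"
  shows "g (A y) \<bullet> A v + rpart h v \<le> g (A y) \<bullet> A z + rpart h z"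
  using subproblem_le[OF assms] finite_value[OF h(1) v_dom] by (simp add: FW_subproblem_def)

lemma G_alt: "G = g (A y) \<bullet> A y - g (A y) \<bullet> A v + rpart h y - rpart h v"
  by (simp add: FW_gap_def linear_diff[OF lin] inner_diff_right)

lemma G_nonneg: "0 \<le> G"
  using v_optimal[OF y_dom] by (simp add: G_alt)

lemma D_nonneg: "0 \<le> D"
  unfolding FW_dist_def by (rule local_norm_nonneg[OF y_int])

lemma R_nonneg: "0 \<le> R"
  using variation[OF y_dom y_dom] by simp

text \<open>Linearizing \<open>f\<close> at \<open>A y\<close> and minimizing over \<open>z\<close> bounds the objective below. Hence the
  optimal value is finite, and the gap \<open>G\<close> certifies the optimality gap.\<close>

lemma lower_bound:
  assumes "z \<in> edom h" "A z \<in> interior K"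
  shows "F y - G \<le> F z"
  using v_optimal[OF assms(1)] gradient_inequality[OF y_int assms(2)]
  by (simp add: G_alt inner_diff_right)

lemma objective_finite:
  assumes "z \<in> edom h" "A z \<in> interior K"
  shows "objective f A h z = ereal (F z)"
  using finite_value[OF h(1) assms(1)] f_finite[OF assms(2)] by (simp add: objective_def)

lemma objective_infinite:
  assumes "\<not> (z \<in> edom h \<and> A z \<in> interior K)"
  shows "objective f A h z = \<infinity>"
proof (cases "A z \<in> interior K")
  case True
  then have "h z = \<infinity>" using assms by (simp add: edom_def)
  then show ?thesis using f_finite[OF True] by (simp add: objective_def)
next
  case False
  moreover have "h z \<noteq> -\<infinity>" using h(1) by (simp add: proper_fun_def)
  ultimately show ?thesis using f_infinite[OF False] by (cases "h z") (simp_all add: objective_def)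
qed

lemma opt_value_bounds:
  "ereal (F y - G) \<le> opt_value f A h"
  "z \<in> edom h \<Longrightarrow> A z \<in> interior K \<Longrightarrow> opt_value f A h \<le> ereal (F z)"
proof -
  show "ereal (F y - G) \<le> opt_value f A h"
    unfolding opt_value_def
  proof (rule INF_greatest)
    fix z
    show "ereal (F y - G) \<le> objective f A h z"
    proof (cases "z \<in> edom h \<and> A z \<in> interior K")
      case True
      then show ?thesis using lower_bound[of z] by (simp add: objective_finite)
    next
      case False
      then show ?thesis by (simp add: objective_infinite)
    qed
  qed
next
  assume "z \<in> edom h" "A z \<in> interior K"
  then show "opt_value f A h \<le> ereal (F z)"
    unfolding opt_value_def by (metis INF_lower UNIV_I objective_finite)
qed

lemma opt_value_finite: "opt_value f A h = ereal Fs"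
  using opt_value_bounds(1) opt_value_bounds(2)[OF y_dom y_int]
  by (cases "opt_value f A h") auto

lemma opt_value_le:
  assumes "z \<in> edom h" "A z \<in> interior K"
  shows "Fs \<le> F z"
  using opt_value_bounds(2)[OF assms] by (subst (asm) opt_value_finite) simp

lemma opt_value_ge: "F y - G \<le> Fs"
  using opt_value_bounds(1) by (subst (asm) opt_value_finite) simp

lemma opt_gap_alt:
  assumes "z \<in> edom h" "A z \<in> interior K"
  shows "opt_gap f A h z = F z - Fs"
  unfolding opt_gap_def objective_finite[OF assms]
  by (subst opt_value_finite) simp

lemma opt_gap_nonneg: "0 \<le> opt_gap f A h y"
  using opt_value_le[OF y_dom y_int] opt_gap_alt[OF y_dom y_int] by linarith

lemma opt_gap_le: "opt_gap f A h y \<le> G"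
  using opt_value_ge opt_gap_alt[OF y_dom y_int] by linarith

text \<open>With \<open>p = - (g (A y) \<bullet> A v)\<close>, the chord estimate reads \<open>D\<^sup>2 \<le> p\<^sup>2 - 2 p + \<theta>\<close>, and
  \<open>0 \<le> p \<le> B\<close> where \<open>B\<close> is the claimed bound. The quadratic is convex in \<open>p\<close>, so only the
  end points 0 and \<open>B\<close> matter, where \<open>1 \<le> \<theta> \<le> B\<close> gives the claim.\<close>

lemma D_le: "D \<le> G + (\<theta> + R)"
proof (rule power2_le_imp_le)
  define p where "p = - (g (A y) \<bullet> A v)"
  define B where "B = G + (\<theta> + R)"
  have Av: "A v \<in> K" using v_dom dom_in_cone by auto
  have p0: "0 \<le> p" using gradient_nonpos[OF y_int Av] by (simp add: p_def)
  have pB: "p \<le> B"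
    using variation[OF v_dom y_dom] gradient_inner_self[OF y_int]
    by (simp add: B_def p_def G_alt)
  have B: "\<theta> \<le> B" using G_nonneg R_nonneg by (simp add: B_def)
  have "D\<^sup>2 \<le> p\<^sup>2 - 2 * p + \<theta>"
    using local_norm_chord[OF y_int Av] by (simp add: FW_dist_def linear_diff[OF lin] p_def)
  also have "\<dots> \<le> B\<^sup>2"
  proof -
    have "p * (B - 2) + B \<le> B * B"
    proof (cases "B \<ge> 2")
      case True
      then have "p * (B - 2) \<le> B * (B - 2)" using pB by (intro mult_right_mono) auto
      then show ?thesis using True by (simp add: algebra_simps)
    next
      case False
      then have "p * (B - 2) \<le> 0" using p0 by (simp add: mult_nonneg_nonpos)
      moreover have "1 * B \<le> B * B" using B theta by (intro mult_right_mono) auto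
      ultimately show ?thesis by simp
    qed
    moreover have "p * p \<le> p * B" using pB p0 by (intro mult_left_mono)
    ultimately show ?thesis
      using B by (simp add: power2_eq_square algebra_simps)
  qed
  finally show "D\<^sup>2 \<le> (G + (\<theta> + R))\<^sup>2" by (simp add: B_def)
  show "0 \<le> G + (\<theta> + R)" using G_nonneg R_nonneg theta by simp
qed

lemma next_feasible: "y' \<in> edom h" "A y' \<in> interior K"
proof -
  note step = FW_step_cases(1-3)[OF G_nonneg D_nonneg]
  show "y' \<in> edom h" by (rule convex_fun_segment(1)[OF h y_dom v_dom step(1,2)])
  have Ay': "A y' = A y + \<alpha> *\<^sub>R A (v - y)"
    by (simp add: linear_add[OF lin] linear_scale[OF lin])
  have end_K: "A y + A (v - y) \<in> K"
    using v_dom dom_in_cone by (auto simp: linear_diff[OF lin])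
  show "A y' \<in> interior K"
  proof (cases "\<alpha> < 1")
    case True
    then show ?thesis unfolding Ay' using segment_interior[OF y_int end_K step(1)] by simp
  next
    case False
    then have one: "\<alpha> = 1" using step(2) by simp
    then have "local_norm f (A y) (A (v - y)) < 1"
      using step(3) by (simp add: FW_dist_def)
    then show ?thesis
      using dikin_interior[OF y_int end_K] unfolding Ay' by (simp only: one scaleR_one)
  qed
qed

lemma opt_gap_decrease:
  "\<alpha> * G + \<alpha> * D + ln (1 - \<alpha> * D) \<le> opt_gap f A h y - opt_gap f A h y'"
proof -
  note step = FW_step_cases(1-3)[OF G_nonneg D_nonneg]
  have Ay': "A y' = A y + \<alpha> *\<^sub>R A (v - y)"
    by (simp add: linear_add[OF lin] linear_scale[OF lin])
  have norm: "local_norm f (A y) (\<alpha> *\<^sub>R A (v - y)) = \<alpha> * D"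
    using local_norm_scale[OF step(1), of "A y" "A (v - y)"] unfolding FW_dist_def .
  have "rpart f (A y') \<le> rpart f (A y) + \<alpha> * (g (A y) \<bullet> A (v - y)) - \<alpha> * D - ln (1 - \<alpha> * D)"
    using upper_bound_within[OF y_int, of "\<alpha> *\<^sub>R A (v - y)"] next_feasible(2) step(3)
    unfolding Ay' norm by simp
  moreover have "rpart h y' \<le> rpart h y - \<alpha> * (rpart h y - rpart h v)"
    by (rule convex_fun_segment(2)[OF h y_dom v_dom step(1,2)])
  moreover have "\<alpha> * G = - \<alpha> * (g (A y) \<bullet> A (v - y)) + \<alpha> * (rpart h y - rpart h v)"
    unfolding G_alt linear_diff[OF lin] inner_diff_right by (simp add: algebra_simps)
  ultimately show ?thesis
    using opt_gap_alt[OF y_dom y_int] opt_gap_alt[OF next_feasible] by simp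
qed

lemma decrease_large:
  assumes "\<theta> + R < G"
  shows "G / (5.3 * (G + (\<theta> + R))) < opt_gap f A h y - opt_gap f A h y'"
  using FW_step_progress(1)[OF G_nonneg D_nonneg _ D_le assms] opt_gap_decrease theta R_nonneg
  by simp

lemma decrease_small:
  assumes "G \<le> \<theta> + R"
  shows "G\<^sup>2 / (12 * (\<theta> + R)\<^sup>2) \<le> opt_gap f A h y - opt_gap f A h y'"
  using FW_step_progress(2)[OF G_nonneg D_nonneg _ D_le assms] opt_gap_decrease theta R_nonneg
  by simp

end

section \<open>Counting iterations\<close>

text \<open>The function \<open>2/\<epsilon> - 1/d\<close> measures progress while \<open>1/d\<close> grows, and for \<open>d \<le> \<epsilon>\<close> it is
  continued by its tangent at \<open>\<epsilon>\<close>, where the decrease of \<open>d\<close> is controlled only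
  by \<open>\<epsilon> < G\<close>. The derivative is \<open>1 / (max d \<epsilon>)\<^sup>2\<close> throughout.\<close>

definition gap_potential :: "real \<Rightarrow> real \<Rightarrow> real" where
  "gap_potential \<epsilon> d = (if d \<le> \<epsilon> then d / \<epsilon>\<^sup>2 else 2 / \<epsilon> - 1 / d)"

lemma gap_potential_range:
  assumes "0 < \<epsilon>" "0 \<le> d"
  shows "0 \<le> gap_potential \<epsilon> d" "gap_potential \<epsilon> d \<le> 2 / \<epsilon>"
  using assms by (auto simp: gap_potential_def field_simps power2_eq_square)

text \<open>The potential is concave, so its graph lies below the tangent at \<open>d\<close>.\<close>

lemma gap_potential_tangent:
  assumes e: "0 < \<epsilon>" and d: "0 \<le> d'" "d' \<le> d"
  shows "gap_potential \<epsilon> d' + (d - d') / (max d \<epsilon>)\<^sup>2 \<le> gap_potential \<epsilon> d"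
proof (cases "d \<le> \<epsilon>")
  case True
  then show ?thesis using d e by (simp add: gap_potential_def field_simps max_def)
next
  case False
  then have d0: "d > 0" using e by simp
  show ?thesis
  proof (cases "d' \<le> \<epsilon>")
    case True
    have "0 \<le> (1 / \<epsilon> - 1 / d) * (2 - d' / \<epsilon> - d' / d)"
    proof (intro mult_nonneg_nonneg)
      show "0 \<le> 1 / \<epsilon> - 1 / d" using False e by (simp add: field_simps)
      have "d' / \<epsilon> \<le> 1" "d' / d \<le> 1" using True e d d0 by auto
      then show "0 \<le> 2 - d' / \<epsilon> - d' / d" by simp
    qed
    also have "\<dots> = 2 / \<epsilon> - 1 / d - (d' / \<epsilon>\<^sup>2 + (d - d') / d\<^sup>2)"
      using e d0 by (simp add: algebra_simps power2_eq_square diff_divide_distrib)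
    finally show ?thesis
      using True False by (simp add: gap_potential_def max_def)
  next
    case False': False
    then have d'0: "d' > 0" using e by simp
    have "(d - d') / d\<^sup>2 \<le> (d - d') / (d * d')"
      using d d0 d'0 by (intro divide_left_mono) (auto simp: power2_eq_square)
    also have "\<dots> = 1 / d' - 1 / d" using d0 d'0 by (simp add: field_simps)
    finally show ?thesis using False False' by (simp add: gap_potential_def max_def)
  qed
qed

text \<open>What the iterations of the method amount to numerically: \<open>\<delta>\<close> is the optimality gap, \<open>G\<close> the
  computable certificate for it, and the guaranteed decrease depends on whether \<open>G\<close> exceeds \<open>c\<close>.\<close>

locale two_phase_descent =
  fixes \<delta> G :: "nat \<Rightarrow> real" and c :: real
  assumes c_ge_1: "1 \<le> c"
    and gap_nonneg: "0 \<le> \<delta> k"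
    and gap_le: "\<delta> k \<le> G k"
    and large: "c < G k \<Longrightarrow> G k / (5.3 * (G k + c)) < \<delta> k - \<delta> (Suc k)"
    and small: "G k \<le> c \<Longrightarrow> (G k)\<^sup>2 / (12 * c\<^sup>2) \<le> \<delta> k - \<delta> (Suc k)"
begin

lemma decreasing: "\<delta> (Suc k) \<le> \<delta> k"
proof (cases "c < G k")
  case True
  have "0 \<le> G k / (5.3 * (G k + c))"
    using True c_ge_1 by (intro divide_nonneg_nonneg) auto
  then show ?thesis using large[OF True] by simp
next
  case False
  have "0 \<le> (G k)\<^sup>2 / (12 * c\<^sup>2)" by simp
  then show ?thesis using small[of k] False by linarith
qed

lemma antitone: "i \<le> j \<Longrightarrow> \<delta> j \<le> \<delta> i"
  using decreasing by (rule lift_Suc_antimono_le)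

text \<open>The function \<open>t / (t + c)\<close> is increasing, so \<open>G k\<close> may be replaced by the smaller \<open>\<delta> k\<close>,
  and the denominator \<open>\<delta> k + c\<close> by the larger \<open>\<delta> 0 + c\<close>.\<close>

lemma linear_decrease:
  assumes "c < G k"
  shows "\<delta> (Suc k) \<le> (1 - 1 / (5.3 * (\<delta> 0 + c))) * \<delta> k"
proof -
  have "\<delta> k / (\<delta> 0 + c) \<le> \<delta> k / (\<delta> k + c)"
    using antitone[of 0 k] gap_nonneg[of k] c_ge_1 by (intro divide_left_mono mult_pos_pos) auto
  also have "\<dots> \<le> G k / (G k + c)"
    using gap_nonneg[of k] gap_le[of k] c_ge_1 assms by (simp add: field_simps)
  finally have "\<delta> k / (5.3 * (\<delta> 0 + c)) \<le> G k / (5.3 * (G k + c))"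
    using divide_right_mono[of "\<delta> k / (\<delta> 0 + c)" "G k / (G k + c)" "5.3"]
    by (simp only: divide_divide_eq_left mult.commute)
  then show ?thesis using large[OF assms] by (simp add: algebra_simps)
qed

lemma large_gap_decrease: "c < G k \<Longrightarrow> 1 / 10.6 < \<delta> k - \<delta> (Suc k)"
proof -
  assume a: "c < G k"
  have "1 / 10.6 \<le> G k / (5.3 * (G k + c))"
    using a c_ge_1 by (simp add: field_simps)
  then show ?thesis using large[OF a] by simp
qed

text \<open>The increase of \<open>1 / \<delta>\<close> is the decrease of \<open>\<delta>\<close> divided by \<open>\<delta> k * \<delta> (Suc k)\<close>, which is at most
  \<open>(G k)\<^sup>2\<close>.\<close>

lemma inverse_gap_increase:
  assumes "G k \<le> c" "0 < \<delta> (Suc k)"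
  shows "1 / \<delta> k + 1 / (12 * c\<^sup>2) \<le> 1 / \<delta> (Suc k)"
proof -
  have pos: "0 < \<delta> k" using assms decreasing[of k] by simp
  have "\<delta> k * \<delta> (Suc k) \<le> (G k)\<^sup>2"
    unfolding power2_eq_square
    using gap_le[of k] decreasing[of k] pos assms by (intro mult_mono) auto
  then have "\<delta> k * \<delta> (Suc k) / (12 * c\<^sup>2) \<le> (G k)\<^sup>2 / (12 * c\<^sup>2)"
    using c_ge_1 by (intro divide_right_mono) auto
  also have "\<dots> \<le> \<delta> k - \<delta> (Suc k)" by (rule small[OF assms(1)])
  finally show ?thesis
    using pos assms(2) c_ge_1 by (simp add: field_simps)
qed

definition large_steps :: "nat set" where "large_steps = {k. c < G k}"

lemma power_bound:
  "\<delta> n \<le> (1 - 1 / (5.3 * (\<delta> 0 + c))) ^ card (large_steps \<inter> {..<n}) * \<delta> 0"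
proof (induction n)
  case 0
  then show ?case by simp
next
  case (Suc n)
  let ?\<rho> = "1 - 1 / (5.3 * (\<delta> 0 + c))"
  have \<rho>: "0 \<le> ?\<rho>" using gap_nonneg[of 0] c_ge_1 by (simp add: field_simps)
  show ?case
  proof (cases "n \<in> large_steps")
    case True
    then have "large_steps \<inter> {..<Suc n} = insert n (large_steps \<inter> {..<n})"
      by (auto simp: less_Suc_eq)
    then have card: "card (large_steps \<inter> {..<Suc n}) = Suc (card (large_steps \<inter> {..<n}))"
      by simp
    have "\<delta> (Suc n) \<le> ?\<rho> * \<delta> n"
      using True by (intro linear_decrease) (simp add: large_steps_def)
    also have "\<dots> \<le> ?\<rho> * (?\<rho> ^ card (large_steps \<inter> {..<n}) * \<delta> 0)"
      using Suc.IH \<rho> by (rule mult_left_mono)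
    finally show ?thesis unfolding card by (simp add: mult.assoc)
  next
    case False
    then have "large_steps \<inter> {..<Suc n} = large_steps \<inter> {..<n}"
      by (auto simp: less_Suc_eq)
    then show ?thesis using Suc.IH decreasing[of n] by (metis order_trans)
  qed
qed

text \<open>At an iteration with large \<open>G\<close> the gap still has to drop by more than \<open>1 / 10.6\<close>, so it
  exceeds that number in spite of the geometric decrease in the earlier such iterations. The
  inequality is strict, so that the iteration \<open>k\<close> itself fits under the ceiling in the next lemma.\<close>

lemma card_earlier_large_steps:
  assumes "k \<in> large_steps"
  shows "real (card (large_steps \<inter> {..<k})) < 5.3 * (\<delta> 0 + c) * ln (10.6 * \<delta> 0)"
proof -
  let ?n = "card (large_steps \<inter> {..<k})"
  define a where "a = 5.3 * (\<delta> 0 + c)"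
  have a: "a > 1" using gap_nonneg[of 0] c_ge_1 by (simp add: a_def)
  have "1 / 10.6 < \<delta> k"
    using large_gap_decrease[of k] gap_nonneg[of "Suc k"] assms by (simp add: large_steps_def)
  also have "\<delta> k \<le> (1 - 1 / a) ^ ?n * \<delta> 0"
    using power_bound[of k] by (simp only: a_def)
  also have "\<dots> \<le> exp (- 1 / a) ^ ?n * \<delta> 0"
    using a gap_nonneg[of 0] exp_ge_add_one_self[of "- 1 / a"]
    by (intro mult_right_mono power_mono) (auto simp: field_simps)
  also have "\<dots> = exp (- (?n / a)) * \<delta> 0"
    by (simp flip: exp_of_nat_mult)
  finally have *: "exp (?n / a) < 10.6 * \<delta> 0"
    by (simp add: exp_minus field_simps)
  have "0 < 10.6 * \<delta> 0"
    by (rule less_trans[OF _ *]) simp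
  then have "?n / a < ln (10.6 * \<delta> 0)"
    using * by (metis exp_less_cancel_iff exp_ln)
  then show ?thesis using a by (simp add: a_def field_simps)
qed

lemma card_large_steps:
  "finite large_steps"
  "int (card large_steps) \<le> max 0 \<lceil>5.3 * (\<delta> 0 + c) * ln (10.6 * \<delta> 0)\<rceil>"
proof -
  let ?M = "max 0 \<lceil>5.3 * (\<delta> 0 + c) * ln (10.6 * \<delta> 0)\<rceil>"
  have "card S \<le> nat ?M" if S: "S \<subseteq> large_steps" "finite S" for S
  proof (cases "S = {}")
    case False
    define k where "k = Max S"
    have k: "k \<in> large_steps" using S False Max_in[of S] unfolding k_def by blast
    have "S \<subseteq> insert k (large_steps \<inter> {..<k})"
      using S by (auto simp: k_def le_neq_implies_less)
    then have "card S \<le> card (insert k (large_steps \<inter> {..<k}))"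
      by (intro card_mono) auto
    also have "\<dots> = Suc (card (large_steps \<inter> {..<k}))" by simp
    also have "int \<dots> \<le> ?M"
      using card_earlier_large_steps[OF k] by linarith
    finally show ?thesis by simp
  qed simp
  then have "finite large_steps \<and> card large_steps \<le> nat ?M"
    by (intro finite_if_finite_subsets_card_bdd) auto
  then show "finite large_steps" "int (card large_steps) \<le> ?M"
    by auto
qed

lemma inverse_gap_bound:
  assumes "0 < \<delta> n"
  shows "1 / \<delta> 0 + card ({..<n} - large_steps) / (12 * c\<^sup>2) \<le> 1 / \<delta> n"
  using assms
proof (induction n)
  case 0
  then show ?case by simp
next
  case (Suc n)
  have pos: "0 < \<delta> n" using Suc.prems decreasing[of n] by simp
  show ?case
  proof (cases "n \<in> large_steps")
    case True
    then have "{..<Suc n} - large_steps = {..<n} - large_steps"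
      by (auto simp: less_Suc_eq)
    moreover have "1 / \<delta> n \<le> 1 / \<delta> (Suc n)"
      using Suc.prems decreasing[of n] pos by (simp add: field_simps)
    ultimately show ?thesis using Suc.IH[OF pos] by simp
  next
    case False
    then have "{..<Suc n} - large_steps = insert n ({..<n} - large_steps)"
      by (auto simp: less_Suc_eq)
    then have "card ({..<Suc n} - large_steps) = Suc (card ({..<n} - large_steps))"
      by simp
    then show ?thesis
      using Suc.IH[OF pos] inverse_gap_increase[of n] False Suc.prems
      by (simp add: large_steps_def add_divide_distrib)
  qed
qed

lemma card_split: "n = card (large_steps \<inter> {..<n}) + card ({..<n} - large_steps)"
  using card_Int_Diff[of "{..<n}" large_steps] by (simp add: Int_commute)

lemma card_large_steps_below:
  "int (card (large_steps \<inter> {..<n})) \<le> max 0 \<lceil>5.3 * (\<delta> 0 + c) * ln (10.6 * \<delta> 0)\<rceil>"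
  using card_mono[of large_steps "large_steps \<inter> {..<n}"] card_large_steps by force

text \<open>The iterations split into those with large \<open>G\<close>, already counted, and the others, each of
  which raises \<open>1 / \<delta>\<close> by \<open>1 / (12 c\<^sup>2)\<close> towards \<open>1 / \<epsilon>\<close>.\<close>

lemma gap_iterations:
  fixes \<epsilon> :: real
  assumes eps: "0 < \<epsilon>"
  defines "B \<equiv> max 0 \<lceil>5.3 * (\<delta> 0 + c) * ln (10.6 * \<delta> 0)\<rceil>
      + \<lceil>12 * c\<^sup>2 * max (1 / \<epsilon> - 1 / \<delta> 0) 0\<rceil>"
  shows "\<exists>k. \<delta> k \<le> \<epsilon>" "int (LEAST k. \<delta> k \<le> \<epsilon>) \<le> B"
proof -
  let ?N = "\<lceil>12 * c\<^sup>2 * max (1 / \<epsilon> - 1 / \<delta> 0) 0\<rceil>"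
  have N: "0 \<le> ?N"
    by (metis ceiling_mono ceiling_zero max.cobounded2 mult_nonneg_nonneg zero_le_numeral
        zero_le_power2)
  then have B: "0 \<le> B" by (simp add: B_def)
  \<comment> \<open>Rounding works out because \<open>\<epsilon> < \<delta> (nat B)\<close> is strict, so the count is below the ceiling.\<close>
  have "\<delta> (nat B) \<le> \<epsilon>"
  proof (rule ccontr)
    assume "\<not> ?thesis"
    then have gt: "\<epsilon> < \<delta> (nat B)" by simp
    have "1 / \<delta> 0 + card ({..<nat B} - large_steps) / (12 * c\<^sup>2) < 1 / \<epsilon>"
      using inverse_gap_bound[of "nat B"] gt eps
      by (smt (verit) frac_less2)
    then have "card ({..<nat B} - large_steps) < 12 * c\<^sup>2 * (1 / \<epsilon> - 1 / \<delta> 0)"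
      using c_ge_1 by (simp add: field_simps)
    also have "\<dots> \<le> 12 * c\<^sup>2 * max (1 / \<epsilon> - 1 / \<delta> 0) 0"
      by (intro mult_left_mono) auto
    finally have "int (card ({..<nat B} - large_steps)) < ?N"
      by linarith
    then show False
      using card_split[of "nat B"] card_large_steps_below[of "nat B"] B unfolding B_def by linarith
  qed
  then show "\<exists>k. \<delta> k \<le> \<epsilon>" "int (LEAST k. \<delta> k \<le> \<epsilon>) \<le> B"
    using Least_le[of "\<lambda>k. \<delta> k \<le> \<epsilon>" "nat B"] B by auto
qed

text \<open>An iteration with \<open>\<epsilon> < G n \<le> c\<close> decreases \<open>\<delta> n\<close> by at least \<open>(max (\<delta> n) \<epsilon>)\<^sup>2 / (12 c\<^sup>2)\<close>,
  hence the potential by at least \<open>1 / (12 c\<^sup>2)\<close>; the other iterations do not increase it.\<close>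

lemma gap_potential_pays:
  assumes eps: "0 < \<epsilon>" and gt: "\<And>k. k < n \<Longrightarrow> \<epsilon> < G k"
  shows "card ({..<n} - large_steps) / (12 * c\<^sup>2)
    \<le> gap_potential \<epsilon> (\<delta> 0) - gap_potential \<epsilon> (\<delta> n)"
  using gt
proof (induction n)
  case 0
  then show ?case by simp
next
  case (Suc n)
  then have IH: "card ({..<n} - large_steps) / (12 * c\<^sup>2)
      \<le> gap_potential \<epsilon> (\<delta> 0) - gap_potential \<epsilon> (\<delta> n)"
    by simp
  have tangent: "gap_potential \<epsilon> (\<delta> (Suc n)) + (\<delta> n - \<delta> (Suc n)) / (max (\<delta> n) \<epsilon>)\<^sup>2
      \<le> gap_potential \<epsilon> (\<delta> n)"
    by (rule gap_potential_tangent[OF eps gap_nonneg decreasing])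
  show ?case
  proof (cases "n \<in> large_steps")
    case True
    then have "{..<Suc n} - large_steps = {..<n} - large_steps"
      by (auto simp: less_Suc_eq)
    moreover have "0 \<le> (\<delta> n - \<delta> (Suc n)) / (max (\<delta> n) \<epsilon>)\<^sup>2"
      using decreasing[of n] by simp
    ultimately show ?thesis using IH tangent by simp
  next
    case False
    then have "{..<Suc n} - large_steps = insert n ({..<n} - large_steps)"
      by (auto simp: less_Suc_eq)
    then have card: "card ({..<Suc n} - large_steps) = Suc (card ({..<n} - large_steps))"
      by simp
    have m: "0 < max (\<delta> n) \<epsilon>" "max (\<delta> n) \<epsilon> \<le> G n"
      using gap_le[of n] Suc.prems[of n] eps by auto
    have "1 / (12 * c\<^sup>2) = (max (\<delta> n) \<epsilon>)\<^sup>2 / (12 * c\<^sup>2) / (max (\<delta> n) \<epsilon>)\<^sup>2"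
      using m by simp
    also have "\<dots> \<le> (G n)\<^sup>2 / (12 * c\<^sup>2) / (max (\<delta> n) \<epsilon>)\<^sup>2"
      using m by (intro divide_right_mono power_mono) auto
    also have "\<dots> \<le> (\<delta> n - \<delta> (Suc n)) / (max (\<delta> n) \<epsilon>)\<^sup>2"
      using False small[of n] by (intro divide_right_mono) (auto simp: large_steps_def)
    finally show ?thesis
      unfolding card using IH tangent by (simp add: add_divide_distrib)
  qed
qed

text \<open>The potential ranges over \<open>[0, 2 / \<epsilon>]\<close> and pays \<open>1 / (12 c\<^sup>2)\<close> for every iteration with
  small but not yet sufficient \<open>G\<close>, which makes at most \<open>24 c\<^sup>2 / \<epsilon>\<close> of them.\<close>

lemma certificate_iterations:
  fixes \<epsilon> :: real
  assumes eps: "0 < \<epsilon>"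
  defines "B \<equiv> max 0 \<lceil>5.3 * (\<delta> 0 + c) * ln (10.6 * \<delta> 0)\<rceil> + \<lceil>24 * c\<^sup>2 / \<epsilon>\<rceil>"
  shows "\<exists>k. G k \<le> \<epsilon>" "int (LEAST k. G k \<le> \<epsilon>) \<le> B"
proof -
  have "0 \<le> 24 * c\<^sup>2 / \<epsilon>" using eps by simp
  then have N: "0 \<le> \<lceil>24 * c\<^sup>2 / \<epsilon>\<rceil>" by linarith
  then have B: "0 \<le> B" by (simp add: B_def)
  have "\<exists>k \<le> nat B. G k \<le> \<epsilon>"
  proof (rule ccontr)
    assume "\<not> ?thesis"
    then have gt: "\<epsilon> < G k" if "k < Suc (nat B)" for k
      using that by (meson less_Suc_eq_le not_le)
    have "card ({..<Suc (nat B)} - large_steps) / (12 * c\<^sup>2) \<le> 2 / \<epsilon>"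
      using gap_potential_pays[OF eps gt] gap_potential_range[OF eps gap_nonneg]
      by (smt (verit, best))
    then have "card ({..<Suc (nat B)} - large_steps) \<le> 24 * c\<^sup>2 / \<epsilon>"
      using c_ge_1 eps by (simp add: field_simps)
    then have "int (card ({..<Suc (nat B)} - large_steps)) \<le> \<lceil>24 * c\<^sup>2 / \<epsilon>\<rceil>"
      by linarith
    then show False
      using card_split[of "Suc (nat B)"] card_large_steps_below[of "Suc (nat B)"] B
      unfolding B_def by linarith
  qed
  then obtain k where k: "k \<le> nat B" "G k \<le> \<epsilon>" by blast
  then show "\<exists>k. G k \<le> \<epsilon>" by blast
  show "int (LEAST k. G k \<le> \<epsilon>) \<le> B"
    using Least_le[of "\<lambda>k. G k \<le> \<epsilon>", OF k(2)] k(1) B by linarith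
qed

end

section \<open>Complexity of the method\<close>

theorem theorem2p1:
  fixes K :: "(real^'m) set" and f :: "real^'m \<Rightarrow> ereal" and \<theta> :: real
    and A :: "real^'n \<Rightarrow> real^'m" and h :: "real^'n \<Rightarrow> ereal"
    and x v :: "nat \<Rightarrow> real^'n" and G \<delta> :: "nat \<Rightarrow> real" and R \<epsilon> :: real
  assumes cone: "regular_cone K"
    and theta: "\<theta> \<ge> 1"
    and barrier: "LHSCB \<theta> K f"
    and lin: "linear A"
    and h: "proper_fun h" "closed_fun h" "convex_fun h"
    and dom_h: "edom h \<noteq> {}" "convex (edom h)" "compact (edom h)"
    and feasible: "A ` edom h \<inter> edom f \<noteq> {}"
    and dom_in_cone: "A ` edom h \<subseteq> K"
    and R_finite: "bdd_above (h_variations h)"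
    and R_def: "R = Sup (h_variations h)"
    and run: "FW_run f A h x v"
    and G_def: "\<And>k. G k = FW_gap f A h (x k) (v k)"
    and delta_def: "\<And>k. \<delta> k = opt_gap f A h (x k)"
    and eps: "\<epsilon> > 0"
  shows
    "(\<forall>k. G k > \<theta> + R \<longrightarrow> \<delta> (Suc k) \<le> (1 - 1 / (5.3 * (\<delta> 0 + \<theta> + R))) * \<delta> k) \<and>
     (\<forall>k. G k \<le> \<theta> + R \<longrightarrow>
        1 / ereal (\<delta> (Suc k)) \<ge> 1 / ereal (\<delta> k) + ereal (1 / (12 * (\<theta> + R)\<^sup>2))) \<and>
     (finite {k. G k > \<theta> + R} \<and>
      int (card {k. G k > \<theta> + R}) \<le> max 0 \<lceil>5.3 * (\<delta> 0 + \<theta> + R) * ln (10.6 * \<delta> 0)\<rceil>) \<and>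
     ((\<exists>k. \<delta> k \<le> \<epsilon>) \<and>
      int (LEAST k. \<delta> k \<le> \<epsilon>) \<le>
        max 0 \<lceil>5.3 * (\<delta> 0 + \<theta> + R) * ln (10.6 * \<delta> 0)\<rceil> +
        \<lceil>12 * (\<theta> + R)\<^sup>2 * max (1 / \<epsilon> - 1 / \<delta> 0) 0\<rceil>) \<and>
     ((\<exists>k. G k \<le> \<epsilon>) \<and>
      int (LEAST k. G k \<le> \<epsilon>) \<le>
        max 0 \<lceil>5.3 * (\<delta> 0 + \<theta> + R) * ln (10.6 * \<delta> 0)\<rceil> +
        \<lceil>24 * (\<theta> + R)\<^sup>2 / \<epsilon>\<rceil>)"
proof -
  interpret lh_barrier \<theta> K f
    by unfold_locales (fact cone theta barrier)+
  have variation: "rpart h y - rpart h z \<le> R" if "y \<in> edom h" "z \<in> edom h" for y z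
  proof -
    have "\<bar>rpart h y - rpart h z\<bar> \<in> h_variations h"
      using that unfolding h_variations_def by blast
    then have "\<bar>rpart h y - rpart h z\<bar> \<le> R"
      unfolding R_def using R_finite by (rule cSup_upper)
    then show ?thesis by simp
  qed
  have step: "frank_wolfe_step \<theta> K f A h R (x k) (v k)"
    if "x k \<in> edom h" "A (x k) \<in> interior K" for k
  proof -
    have "is_arg_min (FW_subproblem f A h (x k)) (\<lambda>_. True) (v k)"
      using run by (simp only: FW_run_def)
    with lh_barrier_axioms lin h(1,3) dom_in_cone variation that show ?thesis
      by (intro frank_wolfe_step.intro frank_wolfe_step_axioms.intro)
  qed
  have next_x: "x (Suc k) = x k + FW_step (G k) (FW_dist f A (x k) (v k)) *\<^sub>R (v k - x k)" for k
    using run by (simp add: FW_run_def G_def)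
  have inv: "x k \<in> edom h \<and> A (x k) \<in> interior K" for k
  proof (induction k)
    case 0
    then show ?case using run edom_f by (simp add: FW_run_def)
  next
    case (Suc k)
    then show ?case
      using frank_wolfe_step.next_feasible[OF step[of k]] by (simp add: next_x G_def)
  qed
  have step: "frank_wolfe_step \<theta> K f A h R (x k) (v k)" for k
    using inv[of k] by (intro step) auto
  interpret two_phase_descent \<delta> G "\<theta> + R"
  proof
    show "1 \<le> \<theta> + R" using theta frank_wolfe_step.R_nonneg[OF step] by simp
    fix k
    show "0 \<le> \<delta> k" "\<delta> k \<le> G k"
      using frank_wolfe_step.opt_gap_nonneg[OF step] frank_wolfe_step.opt_gap_le[OF step]
      by (simp_all add: G_def delta_def)
    show "G k / (5.3 * (G k + (\<theta> + R))) < \<delta> k - \<delta> (Suc k)" if "\<theta> + R < G k"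
      using frank_wolfe_step.decrease_large[OF step] that
      unfolding delta_def next_x G_def by blast
    show "(G k)\<^sup>2 / (12 * (\<theta> + R)\<^sup>2) \<le> \<delta> k - \<delta> (Suc k)" if "G k \<le> \<theta> + R"
      using frank_wolfe_step.decrease_small[OF step] that
      unfolding delta_def next_x G_def by blast
  qed
  have inverse: "1 / ereal (\<delta> k) + ereal (1 / (12 * (\<theta> + R)\<^sup>2)) \<le> 1 / ereal (\<delta> (Suc k))"
    if "G k \<le> \<theta> + R" for k
  proof (cases "\<delta> (Suc k) = 0")
    case True
    \<comment> \<open>The right-hand side is \<open>\<infinity>\<close>, as \<open>1 / 0 = \<infinity>\<close> for extended reals.\<close>
    then show ?thesis by (simp add: divide_ereal_def)
  next
    case False
    then have pos: "0 < \<delta> (Suc k)" "0 < \<delta> k"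
      using gap_nonneg[of "Suc k"] decreasing[of k] by auto
    have "1 / ereal (\<delta> j) = ereal (1 / \<delta> j)" if "0 < \<delta> j" for j
      using that by (simp add: one_ereal_def)
    then show ?thesis
      using inverse_gap_increase[OF that pos(1)] pos by simp
  qed
  show ?thesis
    using linear_decrease inverse card_large_steps gap_iterations[OF eps]
      certificate_iterations[OF eps]
    unfolding large_steps_def by (simp only: add.assoc) blast
qed

end
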